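(* Let $\mathbb{K}$ be a topological field, $E$ a topological $\mathbb{K}$-vector space, $n,m\in\mathbb{N}$, $U\subseteq\mathbb{K}^n$ and $V\subseteq\mathbb{K}^m$ be locally cartesian subsets, and $\alpha\in(\mathbb{N}_0\cup\{\infty\})^n$, $\beta\in(\mathbb{N}_0\cup\{\infty\})^m$. Then $f(x,\cdot)\in C^\beta(V,E)$ for each $f\in C^{(\alpha,\beta)}(U\times V,E)$ and $x\in U$, the map \[ f^\vee\colon U\to C^\beta(V,E),\quad x\mapsto f(x,\cdot) \] is $C^\alpha$, and the mapping \[ \Phi\colon C^{(\alpha,\beta)}(U\times V,E)\to C^\alpha(U,C^\beta(V,E)),\quad f\mapsto f^\vee \] is $\mathbb{K}$-linear and a topological embedding. If $\mathbb{K}$ is metrizable (e.g. if $\mathbb{K}$ is a valued field), then $\Phi$ is an isomorphism of topological $\mathbb{K}$-vector spaces.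
   Context: All topological fields are Hausdorff and non-discrete; all topological vector spaces are Hausdorff; $\mathbb{K}^n$ carries the product topology. A valued field is a field with an absolute value $|\cdot|$ defining a non-discrete topology. $\mathbb{N}=\{1,2,\ldots\}$, $\mathbb{N}_0=\mathbb{N}\cup\{0\}$. A topological embedding is a map that is a homeomorphism onto its image. A subset $U\subseteq\mathbb{K}^n$ is cartesian if $U=U_1\times\cdots\times U_n$ with subsets $U_i\subseteq\mathbb{K}$ without isolated points; it is locally cartesian if every point of $U$ has a relatively open neighbourhood in $U$ which is cartesian. For $\alpha,\beta\in(\mathbb{N}_0\cup\{\infty\})^n$, $\beta\le\alpha$ is meant componentwise. Let $U=U_1\times\cdots\times U_n\subseteq\mathbb{K}^n$ be cartesian, $f\colon U\to E$ a map to a topological $\mathbb{K}$-vector space and $\beta\in\mathbb{N}_0^n$. Put $U^{<\beta>}:=U_1^{1+\beta_1}\times\cdots\times U_n^{1+\beta_n}$, with elements written $x=(x^{(1)},\ldots,x^{(n)})$, $x^{(i)}=(x^{(i)}_0,\ldots,x^{(i)}_{\beta_i})$, and let $U^{>\beta<}$ be the (dense, open) set of $x\in U^{<\beta>}$ with $x^{(i)}_j\ne x^{(i)}_k$ for all $i$ and $0\le j<k\le\beta_i$. Define $f^{>\beta<}\colon U^{>\beta<}\to E$ by \[ f^{>\beta<}(x)=\sum_{j_1=0}^{\beta_1}\cdots\sum_{j_n=0}^{\beta_n}\Big(\prod_{i=1}^n\ \prod_{k_i\in\{0,\ldots,\beta_i\}\setminus\{j_i\}}\frac{1}{x^{(i)}_{j_i}-x^{(i)}_{k_i}}\Big)f(x^{(1)}_{j_1},\ldots,x^{(n)}_{j_n})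 \] (empty products are $1$). For $\alpha\in(\mathbb{N}_0\cup\{\infty\})^n$, $f$ is called $C^\alpha$ if for every $\beta\in\mathbb{N}_0^n$ with $\beta\le\alpha$ the map $f^{>\beta<}$ has a (necessarily unique) continuous extension $f^{<\beta>}\colon U^{<\beta>}\to E$. If $U$ is only locally cartesian, $f\colon U\to E$ is called $C^\alpha$ if $f|_V$ is $C^\alpha$ for each cartesian relatively open subset $V\subseteq U$. $C^\alpha(U,E)$ is the vector space of all $C^\alpha$-maps $U\to E$, endowed with the compact-open $C^\alpha$-topology: the initial topology with respect to the maps $C^\alpha(U,E)\to C(V^{<\beta>},E)$, $f\mapsto(f|_V)^{<\beta>}$, for all $\beta\in\mathbb{N}_0^n$ with $\beta\le\alpha$ and all cartesian relatively open $V\subseteq U$, where $C(V^{<\beta>},E)$ has the compact-open topology. This makes $C^\alpha(U,E)$ a topological vector space. Here $(\alpha,\beta)\in(\mathbb{N}_0\cup\{\infty\})^{n+m}$ is the concatenation and $U\times V\subseteq\mathbb{K}^{n+m}$. *)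

theory Defs
  imports "HOL-Analysis.Analysis" "HOL-Library.Function_Algebras" "HOL-Library.Extended_Nat"
begin

class topological_field =
  field + t2_space + topological_ab_group_add + topological_semigroup_mult +
  assumes tendsto_inverse_nhds: "a \<noteq> 0 \<Longrightarrow> (inverse \<longlongrightarrow> inverse a) (nhds a)"
    and not_discrete: "\<exists>S. \<not> open S"

text \<open>
  A topological vector space is given by a topology whose carrier is a linear subspace of an
  ambient vector space. The carrier need not be a full type, since spaces of
  \<open>C\<^sup>\<alpha>\<close>-maps have to occur as target spaces themselves.
\<close>

locale topological_vector_space = vector_space smul
  for smul :: "'k::topological_field \<Rightarrow> 'e::ab_group_add \<Rightarrow> 'e" +
  fixes E :: "'e topology"
  assumes subspace_topspace: "subspace (topspace E)"
    and Hausdorff: "Hausdorff_space E"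
    and continuous_add: "continuous_map (prod_topology E E) E (\<lambda>(x, y). x + y)"
    and continuous_scale: "continuous_map (prod_topology euclidean E) E (\<lambda>(c, x). smul c x)"

definition fun_scale :: "('k \<Rightarrow> 'e \<Rightarrow> 'e) \<Rightarrow> 'k \<Rightarrow> ('a \<Rightarrow> 'e) \<Rightarrow> ('a \<Rightarrow> 'e)" where
  "fun_scale smul c f = (\<lambda>x. smul c (f x))"

definition linear_map_on ::
  "('k \<Rightarrow> 'e::plus \<Rightarrow> 'e) \<Rightarrow> ('k \<Rightarrow> 'f::plus \<Rightarrow> 'f) \<Rightarrow> 'e set \<Rightarrow> ('e \<Rightarrow> 'f) \<Rightarrow> bool" where
  "linear_map_on smul1 smul2 S L \<longleftrightarrow>
     (\<forall>x\<in>S. \<forall>y\<in>S. L (x + y) = L x + L y) \<and> (\<forall>c. \<forall>x\<in>S. L (smul1 c x) = smul2 c (L x))"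

definition tvs_isomorphism ::
  "('k \<Rightarrow> 'e::plus \<Rightarrow> 'e) \<Rightarrow> 'e topology \<Rightarrow> ('k \<Rightarrow> 'f::plus \<Rightarrow> 'f) \<Rightarrow> 'f topology \<Rightarrow> ('e \<Rightarrow> 'f) \<Rightarrow> bool"
  where
  "tvs_isomorphism smul1 E smul2 F L \<longleftrightarrow>
     linear_map_on smul1 smul2 (topspace E) L \<and> homeomorphic_map E F L"

definition initial_topology :: "'a set \<Rightarrow> 'i set \<Rightarrow> ('i \<Rightarrow> 'b topology) \<Rightarrow> ('i \<Rightarrow> 'a \<Rightarrow> 'b) \<Rightarrow> 'a topology"
  where
  "initial_topology S I T f =
     topology_generated_by (insert S {S \<inter> f i -` W |i W. i \<in> I \<and> openin (T i) W})"

lemma topspace_initial_topology [simp]: "topspace (initial_topology S I T f) = S"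
  by (auto simp: initial_topology_def)

text \<open>Elements of \<open>C(X, Y)\<close> are normalised to be \<open>undefined\<close> outside the space \<open>X\<close>.\<close>

definition continuous_maps :: "'a topology \<Rightarrow> 'b topology \<Rightarrow> ('a \<Rightarrow> 'b) set" where
  "continuous_maps X Y = {g \<in> extensional (topspace X). continuous_map X Y g}"

definition compact_open_topology :: "'a topology \<Rightarrow> 'b topology \<Rightarrow> ('a \<Rightarrow> 'b) topology" where
  "compact_open_topology X Y =
     topology_generated_by
       {{g \<in> continuous_maps X Y. g ` K \<subseteq> W} |K W. compactin X K \<and> openin Y W}"

lemma topspace_compact_open_topology [simp]:
  "topspace (compact_open_topology X Y) = continuous_maps X Y"
proof -
  have "continuous_maps X Y \<in>
      {{g \<in> continuous_maps X Y. g ` K \<subseteq> W} |K W. compactin X K \<and> openin Y W}"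
    by (intro CollectI exI[of _ "{}"]) auto
  then show ?thesis
    unfolding compact_open_topology_def topology_generated_by_topspace by blast
qed

definition box_of :: "('n \<Rightarrow> 'k set) \<Rightarrow> ('k ^ 'n) set" where
  "box_of A = {x. \<forall>i. x $ i \<in> A i}"

definition no_isolated_points :: "'k::topological_space set \<Rightarrow> bool" where
  "no_isolated_points S \<longleftrightarrow> (\<forall>x. \<not> x isolated_in S)"

definition cartesian :: "('k::topological_space ^ 'n) set \<Rightarrow> bool" where
  "cartesian U \<longleftrightarrow> (\<exists>A. (\<forall>i. no_isolated_points (A i)) \<and> U = box_of A)"

definition locally_cartesian :: "('k::topological_space ^ 'n) set \<Rightarrow> bool" where
  "locally_cartesian U \<longleftrightarrow>
     (\<forall>x\<in>U. \<exists>W. x \<in> W \<and> openin (top_of_set U) W \<and> cartesian W)"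

text \<open>
  Cartesian subsets of \<open>U\<close> are addressed through their families of factors. The family is
  determined by the set unless the set is empty, in which case all the spaces \<open>multi_space A \<beta>\<close>
  below are empty as well.
\<close>

definition cartesian_open_factors :: "('k::topological_space ^ 'n) set \<Rightarrow> ('n \<Rightarrow> 'k set) set" where
  "cartesian_open_factors U =
     {A. (\<forall>i. no_isolated_points (A i)) \<and> openin (top_of_set U) (box_of A)}"

text \<open>\<open>K\<^sup>n \<times> K\<^sup>m\<close> is identified with \<open>K\<^sup>n\<^sup>+\<^sup>m\<close>, indexed by the sum of the index types.\<close>

definition vec_append :: "'k ^ 'n \<Rightarrow> 'k ^ 'm \<Rightarrow> 'k ^ ('n + 'm)" where
  "vec_append x y = (\<chi> i. case i of Inl a \<Rightarrow> x $ a | Inr b \<Rightarrow> y $ b)"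

definition vec_Times :: "('k ^ 'n) set \<Rightarrow> ('k ^ 'm) set \<Rightarrow> ('k ^ ('n + 'm)) set" where
  "vec_Times U V = {vec_append x y |x y. x \<in> U \<and> y \<in> V}"

text \<open>
  For \<open>U = box_of A\<close>, the space \<open>U\<^sup><\<^sup>\<beta>\<^sup>>\<close> consists of families \<open>x\<close> with
  \<open>x (i, j) \<in> A i\<close> for \<open>0 \<le> j \<le> \<beta> i\<close>; the value \<open>x (i, j)\<close> is the \<open>j\<close>-th entry of the
  \<open>i\<close>-th block of \<open>x\<close>.
\<close>

definition multi_space :: "('n \<Rightarrow> 'k::topological_space set) \<Rightarrow> ('n \<Rightarrow> nat) \<Rightarrow> ('n \<times> nat \<Rightarrow> 'k) topology"
  where
  "multi_space A \<beta> =
     product_topology (\<lambda>(i, j). top_of_set (A i)) (SIGMA i:UNIV. {0..\<beta> i})"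

definition multi_distinct :: "('n \<Rightarrow> 'k::topological_space set) \<Rightarrow> ('n \<Rightarrow> nat) \<Rightarrow> ('n \<times> nat \<Rightarrow> 'k) set"
  where
  "multi_distinct A \<beta> =
     {x \<in> topspace (multi_space A \<beta>). \<forall>i j k. j < k \<and> k \<le> \<beta> i \<longrightarrow> x (i, j) \<noteq> x (i, k)}"

text \<open>
  The iterated sum over \<open>j\<^sub>1, \<dots>, j\<^sub>n\<close> is written as one sum over multi-indices
  \<open>j \<le> \<beta>\<close>.
\<close>

definition diff_quot ::
  "('k::field \<Rightarrow> 'e::comm_monoid_add \<Rightarrow> 'e) \<Rightarrow> ('n::finite \<Rightarrow> nat) \<Rightarrow> ('k ^ 'n \<Rightarrow> 'e) \<Rightarrow> ('n \<times> nat \<Rightarrow> 'k) \<Rightarrow> 'e"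
  where
  "diff_quot smul \<beta> f x =
     (\<Sum>j | \<forall>i. j i \<le> \<beta> i.
        smul (\<Prod>i\<in>UNIV. \<Prod>k\<in>{0..\<beta> i} - {j i}. 1 / (x (i, j i) - x (i, k)))
              (f (\<chi> i. x (i, j i))))"

lemma finite_multi_indices: "finite {j :: 'n::finite \<Rightarrow> nat. \<forall>i. j i \<le> \<beta> i}"
proof -
  have "{j. \<forall>i. j i \<le> \<beta> i} = (\<Pi>\<^sub>E i\<in>UNIV. {0..\<beta> i})"
    by (auto simp: PiE_def)
  then show ?thesis
    by (simp add: finite_PiE)
qed

definition is_diff_ext ::
  "('k::topological_field \<Rightarrow> 'e::ab_group_add \<Rightarrow> 'e) \<Rightarrow> 'e topology \<Rightarrow> ('n::finite \<Rightarrow> 'k set) \<Rightarrow>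
   ('n \<Rightarrow> nat) \<Rightarrow> ('k ^ 'n \<Rightarrow> 'e) \<Rightarrow> (('n \<times> nat \<Rightarrow> 'k) \<Rightarrow> 'e) \<Rightarrow> bool" where
  "is_diff_ext smul E A \<beta> f g \<longleftrightarrow>
     g \<in> continuous_maps (multi_space A \<beta>) E \<and>
     (\<forall>x\<in>multi_distinct A \<beta>. g x = diff_quot smul \<beta> f x)"

definition diff_ext ::
  "('k::topological_field \<Rightarrow> 'e::ab_group_add \<Rightarrow> 'e) \<Rightarrow> 'e topology \<Rightarrow> ('n::finite \<Rightarrow> 'k set) \<Rightarrow>
   ('n \<Rightarrow> nat) \<Rightarrow> ('k ^ 'n \<Rightarrow> 'e) \<Rightarrow> ('n \<times> nat \<Rightarrow> 'k) \<Rightarrow> 'e" where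
  "diff_ext smul E A \<beta> f = (THE g. is_diff_ext smul E A \<beta> f g)"

definition C_map ::
  "('k::topological_field \<Rightarrow> 'e::ab_group_add \<Rightarrow> 'e) \<Rightarrow> 'e topology \<Rightarrow> ('n::finite \<Rightarrow> enat) \<Rightarrow>
   ('k ^ 'n) set \<Rightarrow> ('k ^ 'n \<Rightarrow> 'e) \<Rightarrow> bool" where
  "C_map smul E \<alpha> U f \<longleftrightarrow>
     f ` U \<subseteq> topspace E \<and>
     (\<forall>A\<in>cartesian_open_factors U. \<forall>\<beta>. (\<forall>i. enat (\<beta> i) \<le> \<alpha> i) \<longrightarrow>
        (\<exists>g. is_diff_ext smul E A \<beta> f g))"

text \<open>
  Maps on \<open>U\<close> are normalised to be \<open>0\<close> outside \<open>U\<close>, so that the maps of class \<open>C\<^sup>\<alpha>\<close> on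
  \<open>U\<close> correspond to elements of a linear subspace of the pointwise function space.
\<close>

definition C_space ::
  "('k::topological_field \<Rightarrow> 'e::ab_group_add \<Rightarrow> 'e) \<Rightarrow> 'e topology \<Rightarrow> ('n::finite \<Rightarrow> enat) \<Rightarrow>
   ('k ^ 'n) set \<Rightarrow> ('k ^ 'n \<Rightarrow> 'e) topology" where
  "C_space smul E \<alpha> U =
     initial_topology
       {f. C_map smul E \<alpha> U f \<and> (\<forall>x. x \<notin> U \<longrightarrow> f x = 0)}
       {(A, \<beta>). A \<in> cartesian_open_factors U \<and> (\<forall>i. enat (\<beta> i) \<le> \<alpha> i)}
       (\<lambda>(A, \<beta>). compact_open_topology (multi_space A \<beta>) E)
       (\<lambda>(A, \<beta>) f. diff_ext smul E A \<beta> f)"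

text \<open>
  The map \<open>x \<mapsto> f(x, \<cdot>)\<close>. If \<open>f\<close> vanishes outside \<open>U \<times> V\<close>, then \<open>f(x, \<cdot>)\<close> vanishes outside
  \<open>V\<close>, and it is zero for \<open>x\<close> outside \<open>U\<close>; so the normalisation above is respected.
\<close>

definition curry_vec :: "('k ^ ('n + 'm) \<Rightarrow> 'e) \<Rightarrow> 'k ^ 'n \<Rightarrow> 'k ^ 'm \<Rightarrow> 'e" where
  "curry_vec f = (\<lambda>x y. f (vec_append x y))"

end

(*
  The extended difference quotients of f on a box A x B satisfy
  f^<(a,b)>(x,y) = ((f^)^<a>(x))^<b>(y), where f^ is the curried map: this holds for pairwise distinct
  entries by rearranging the finite sum, and on the whole space by density of such points.
  So everything reduces to the relation between C(X x Y, E) and C(X, C(Y, E)) for Hausdorff spaces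
  X and Y: currying is always a topological embedding, since compact sets in X x Y can be covered by
  finitely many small compact rectangles, and it is onto if X x Y is metrizable, since continuity of
  the uncurried map can then be tested on convergent sequences.
*)

theory Submission
  imports Defs
begin

text \<open>Two obstacles shape the proof. At points x with repeated entries, the outer quotient of
  the curried map exists only as a limit in a function space, so the identity cannot even be stated
  before the curried map is known to be C^\<alpha>. The candidate is therefore built pointwise: for
  each fixed v the slice f(.,v) is C^\<alpha>, since its quotients are those of f of order (a,0)
  with the second argument frozen. The values of their extensions at x, read as a function of v,
  form \<open>partial_ext\<close>; only afterwards is this function shown to be C^\<beta> in v and
  to depend continuously on x. The second obstacle is that the values lie in C^\<beta>(V,E), whose
  topology is itself given by a subbase of conditions "a compact set is mapped into an open set". A
  compact-open topology with such a target can be tested on the target's subbase only after compact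
  sets of the source are cut into small compact pieces, which is done by regularity of compact
  Hausdorff spaces. With this, nested conditions on the curried map match conditions on f over
  products of two compact sets.\<close>

subsection \<open>Initial and compact-open topologies\<close>

lemma continuous_map_initial_topology:
  assumes "g \<in> topspace Z \<rightarrow> S"
    and "\<And>i. i \<in> I \<Longrightarrow> continuous_map Z (T i) (\<lambda>z. f i (g z))"
  shows "continuous_map Z (initial_topology S I T f) g"
  unfolding initial_topology_def
proof (rule continuous_on_generated_topo)
  show "openin Z (g -` Q \<inter> topspace Z)"
    if Q: "Q \<in> insert S {S \<inter> f i -` W |i W. i \<in> I \<and> openin (T i) W}" for Q
  proof (cases "Q = S")
    case True
    then have "g -` Q \<inter> topspace Z = topspace Z" using assms(1) by auto
    then show ?thesis by simp
  next
    case False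
    then obtain i W where iW: "i \<in> I" "openin (T i) W" "Q = S \<inter> f i -` W" using Q by auto
    then have "g -` Q \<inter> topspace Z = {z \<in> topspace Z. f i (g z) \<in> W}" using assms(1) by auto
    then show ?thesis using openin_continuous_map_preimage[OF assms(2)] iW by simp
  qed
qed (use assms(1) in auto)

lemma continuous_map_from_initial_topology:
  assumes "i \<in> I" "f i \<in> S \<rightarrow> topspace (T i)"
  shows "continuous_map (initial_topology S I T f) (T i) (f i)"
  unfolding continuous_map_def
proof (intro conjI allI impI)
  show "f i \<in> topspace (initial_topology S I T f) \<rightarrow> topspace (T i)" using assms by simp
  fix W assume W: "openin (T i) W"
  have "{x \<in> topspace (initial_topology S I T f). f i x \<in> W} = S \<inter> f i -` W" by auto
  also have "openin (initial_topology S I T f) \<dots>"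
    unfolding initial_topology_def using assms(1) W
    by (intro topology_generated_by_Basis) blast
  finally show "openin (initial_topology S I T f) {x \<in> topspace (initial_topology S I T f). f i x \<in> W}" .
qed

lemma continuous_map_compact_open_topology:
  assumes "\<And>z. z \<in> topspace Z \<Longrightarrow> g z \<in> continuous_maps X Y"
    and "\<And>K W. \<lbrakk>compactin X K; openin Y W\<rbrakk> \<Longrightarrow> openin Z {z \<in> topspace Z. g z ` K \<subseteq> W}"
  shows "continuous_map Z (compact_open_topology X Y) g"
  unfolding compact_open_topology_def
proof (rule continuous_on_generated_topo)
  show "openin Z (g -` Q \<inter> topspace Z)"
    if Q: "Q \<in> {{g \<in> continuous_maps X Y. g ` K \<subseteq> W} |K W. compactin X K \<and> openin Y W}" for Q
  proof -
    obtain K W where KW: "compactin X K" "openin Y W" "Q = {g \<in> continuous_maps X Y. g ` K \<subseteq> W}"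
      using Q[unfolded mem_Collect_eq] by (elim exE conjE) metis
    then have "g -` Q \<inter> topspace Z = {z \<in> topspace Z. g z ` K \<subseteq> W}" using assms(1) by auto
    then show ?thesis using assms(2) KW by simp
  qed
  let ?S = "{{g \<in> continuous_maps X Y. g ` K \<subseteq> W} |K W. compactin X K \<and> openin Y W}"
  \<comment> \<open>The empty compact set imposes no condition, so the whole of
    \<open>continuous_maps X Y\<close> is subbasic and the family covers the space.\<close>
  have "{g \<in> continuous_maps X Y. g ` {} \<subseteq> {}} \<in> ?S"
    by (intro CollectI exI[of _ "{}"] conjI refl) simp_all
  then have *: "{g \<in> continuous_maps X Y. g ` {} \<subseteq> {}} \<subseteq> \<Union>?S" by (rule Union_upper)
  show "g ` topspace Z \<subseteq> \<Union>?S" by (rule subset_trans[OF _ *]) (use assms(1) in auto)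
qed

lemma openin_compact_open_topology:
  assumes "compactin X K" "openin Y W"
  shows "openin (compact_open_topology X Y) {g \<in> continuous_maps X Y. g ` K \<subseteq> W}"
  unfolding compact_open_topology_def using assms by (intro topology_generated_by_Basis CollectI
      exI[of _ K] exI[of _ W] conjI refl)

text \<open>The compact Hausdorff subspace \<open>K\<close> is regular, so \<open>x\<close> can be
  separated from \<open>K - Q\<close>; removing from \<open>K\<close> the open set around
  \<open>K - Q\<close> leaves a compact \<open>L\<close>. Compactness of \<open>K\<close> stands in
  for local compactness of \<open>X\<close>. \<open>P\<close> is open in \<open>X\<close>, not
  merely in \<open>K\<close>, so that such sets can serve in an open cover of
  \<open>K\<close>.\<close>

lemma compact_neighbourhood_within:
  assumes "Hausdorff_space X" and K: "compactin X K" and Q: "openin (subtopology X K) Q" and "x \<in> Q"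
  obtains P L where "openin X P" "x \<in> P" "K \<inter> P \<subseteq> L" "L \<subseteq> Q" "compactin X L"
proof -
  let ?K = "subtopology X K"
  have KX: "K \<subseteq> topspace X" using K compactin_subset_topspace by blast
  then have top: "topspace ?K = K" by auto
  have "regular_space ?K"
    using assms by (intro compact_Hausdorff_imp_regular_space compact_space_subtopology Hausdorff_space_subtopology)
  moreover have "closedin ?K (K - Q)" using Q top by (metis closedin_diff closedin_topspace)
  moreover have "x \<in> topspace ?K - (K - Q)" using Q top \<open>x \<in> Q\<close> openin_subset by blast
  ultimately obtain P R where PR: "openin ?K P" "openin ?K R" "x \<in> P" "K - Q \<subseteq> R" "disjnt P R"
    unfolding regular_space_def by meson
  obtain P' where P': "openin X P'" "P = P' \<inter> K" using PR(1) by (auto simp: openin_subtopology)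
  show thesis
  proof
    show "openin X P'" "x \<in> P'" using P' PR by auto
    show "K \<inter> P' \<subseteq> K - R" using PR P' by (auto simp: disjnt_def)
    show "K - R \<subseteq> Q" using PR by auto
    have "closedin ?K (K - R)" using PR top by (metis closedin_diff closedin_topspace)
    then have "compactin ?K (K - R)"
      using K closedin_compact_space compact_space_subtopology by blast
    then show "compactin X (K - R)" by (simp add: compactin_subtopology)
  qed
qed

text \<open>\<open>R\<close> hides existential data attached to an open set, so that witnesses can
  be chosen after the cover has become finite.\<close>

lemma compactin_finite_cover:
  assumes K: "compactin X K" and "\<And>x. x \<in> K \<Longrightarrow> \<exists>P. openin X P \<and> x \<in> P \<and> R P"
  shows "\<exists>\<F>. finite \<F> \<and> (\<forall>P\<in>\<F>. R P) \<and> K \<subseteq> \<Union>\<F>"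
proof -
  have "\<forall>P\<in>{P. openin X P \<and> R P}. openin X P" "K \<subseteq> \<Union>{P. openin X P \<and> R P}"
    using assms(2) by auto
  then obtain \<F> where "finite \<F>" "\<F> \<subseteq> {P. openin X P \<and> R P}" "K \<subseteq> \<Union>\<F>"
    using K unfolding compactin_def by (metis (no_types, lifting))
  then show ?thesis by blast
qed

text \<open>
  A compact Hausdorff set is covered by finitely many smaller compact sets, each of which is
  mapped into a finite intersection of subbasic sets.
\<close>

lemma continuous_map_compact_open_generated:
  assumes X: "Hausdorff_space X"
    and g: "\<And>z. z \<in> topspace Z \<Longrightarrow> g z \<in> continuous_maps X (topology_generated_by \<S>)"
    and sub: "\<And>K s. \<lbrakk>compactin X K; s \<in> \<S>\<rbrakk> \<Longrightarrow> openin Z {z \<in> topspace Z. g z ` K \<subseteq> s}"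
  shows "continuous_map Z (compact_open_topology X (topology_generated_by \<S>)) g"
proof (rule continuous_map_compact_open_topology[OF g])
  fix K W assume K: "compactin X K" and "openin (topology_generated_by \<S>) W"
  then have "generate_topology_on \<S> W" by (simp add: openin_topology_generated_by)
  then have loc: "\<exists>P L N. openin X P \<and> x \<in> P \<and> K \<inter> P \<subseteq> L \<and> compactin X L \<and>
      openin Z N \<and> z \<in> N \<and> (\<forall>z'\<in>N. g z' ` L \<subseteq> W)"
    if "z \<in> topspace Z" "x \<in> K" "g z x \<in> W" for z x
    using that
  proof (induction arbitrary: z x rule: generate_topology_on.induct)
    case Empty
    then show ?case by simp
  next
    case (Int a b)
    obtain P L N where 1: "openin X P" "x \<in> P" "K \<inter> P \<subseteq> L" "compactin X L"
      "openin Z N" "z \<in> N" "\<forall>z'\<in>N. g z' ` L \<subseteq> a"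
      using Int.IH(1)[of z x] Int.prems by blast
    obtain P' L' N' where 2: "openin X P'" "x \<in> P'" "K \<inter> P' \<subseteq> L'" "compactin X L'"
      "openin Z N'" "z \<in> N'" "\<forall>z'\<in>N'. g z' ` L' \<subseteq> b"
      using Int.IH(2)[of z x] Int.prems by blast
    have "compactin X (L \<inter> L')"
      using 1 2 X by (meson closed_Int_compactin compactin_imp_closedin)
    then show ?case
    proof (intro exI conjI)
      show "openin X (P \<inter> P')" "x \<in> P \<inter> P'" "K \<inter> (P \<inter> P') \<subseteq> L \<inter> L'"
        "openin Z (N \<inter> N')" "z \<in> N \<inter> N'"
        using 1(1-3,5,6) 2(1-3,5,6) by auto
      show "\<forall>z'\<in>N \<inter> N'. g z' ` (L \<inter> L') \<subseteq> a \<inter> b" using 1(7) 2(7) by blast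
    qed
  next
    case (UN \<A>)
    then obtain A where A: "A \<in> \<A>" "g z x \<in> A" by blast
    obtain P L N where 1: "openin X P" "x \<in> P" "K \<inter> P \<subseteq> L" "compactin X L"
      "openin Z N" "z \<in> N" "\<forall>z'\<in>N. g z' ` L \<subseteq> A"
      using UN.IH[OF A(1) UN.prems(1,2) A(2)] by blast
    then have "\<forall>z'\<in>N. g z' ` L \<subseteq> \<Union>\<A>" using A(1) by (meson Union_upper subset_trans)
    with 1 show ?case by (intro exI conjI)
  next
    case (Basis s)
    have cont: "continuous_map X (topology_generated_by \<S>) (g z)"
      using g[OF Basis.prems(1)] by (simp add: continuous_maps_def)
    have "openin X {x \<in> topspace X. g z x \<in> s}"
      by (rule openin_continuous_map_preimage[OF cont topology_generated_by_Basis[OF Basis.hyps]])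
    then have "openin (subtopology X K) ({x \<in> topspace X. g z x \<in> s} \<inter> K)"
      by (auto simp: openin_subtopology)
    moreover have "x \<in> {x \<in> topspace X. g z x \<in> s} \<inter> K"
      using Basis.prems K compactin_subset_topspace by blast
    ultimately obtain P L where PL: "openin X P" "x \<in> P" "K \<inter> P \<subseteq> L"
        "L \<subseteq> {x \<in> topspace X. g z x \<in> s} \<inter> K" "compactin X L"
      by (rule compact_neighbourhood_within[OF X K])
    have "openin Z {z \<in> topspace Z. g z ` L \<subseteq> s}" by (rule sub[OF PL(5) Basis.hyps])
    then show ?case using PL Basis.prems
      by (intro exI[of _ P] exI[of _ L] exI[of _ "{z \<in> topspace Z. g z ` L \<subseteq> s}"]) auto
  qed
  show "openin Z {z \<in> topspace Z. g z ` K \<subseteq> W}"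
  proof (subst openin_subopen, clarify)
    fix z assume z: "z \<in> topspace Z" "g z ` K \<subseteq> W"
    let ?R = "\<lambda>P. \<exists>N. openin Z N \<and> z \<in> N \<and> (\<forall>z'\<in>N. g z' ` (K \<inter> P) \<subseteq> W)"
    have near: "\<exists>P. openin X P \<and> x \<in> P \<and> ?R P" if "x \<in> K" for x
    proof -
      have "g z x \<in> W" using z(2) that by blast
      from loc[OF z(1) that this]
      obtain P L N where 1: "openin X P" "x \<in> P" "K \<inter> P \<subseteq> L" "compactin X L"
          "openin Z N" "z \<in> N" "\<forall>z'\<in>N. g z' ` L \<subseteq> W"
        by auto
      then have "\<forall>z'\<in>N. g z' ` (K \<inter> P) \<subseteq> W" by blast
      with 1 show ?thesis by blast
    qed
    have "\<exists>\<F>. finite \<F> \<and> (\<forall>P\<in>\<F>. ?R P) \<and> K \<subseteq> \<Union>\<F>"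
      by (rule compactin_finite_cover[OF K]) (rule near)
    then obtain \<F> where F: "finite \<F>" "\<forall>P\<in>\<F>. ?R P" "K \<subseteq> \<Union>\<F>"
      by (elim exE conjE)
    from F(2) obtain N where N: "\<And>P. P \<in> \<F> \<Longrightarrow> openin Z (N P) \<and> z \<in> N P \<and> (\<forall>z'\<in>N P. g z' ` (K \<inter> P) \<subseteq> W)"
      by metis
    \<comment> \<open>The factor \<open>topspace Z\<close> keeps the set open and inside the space
      when \<open>\<F>\<close> is empty.\<close>
    let ?T = "topspace Z \<inter> \<Inter>(N ` \<F>)"
    have "openin Z ?T"
    proof (cases "\<F> = {}")
      case False
      then show ?thesis using F(1) N by (intro openin_Int openin_topspace openin_Inter) auto
    qed simp
    moreover have "z \<in> ?T" using N z by auto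
    moreover have "?T \<subseteq> {z \<in> topspace Z. g z ` K \<subseteq> W}"
    proof (clarify)
      fix z' x assume z': "z' \<in> topspace Z" "z' \<in> \<Inter>(N ` \<F>)" "x \<in> K"
      then obtain P where "P \<in> \<F>" "x \<in> P" using F(3) by blast
      then show "g z' x \<in> W" using N[of P] z' by auto
    qed
    ultimately show "\<exists>T. openin Z T \<and> z \<in> T \<and> T \<subseteq> {z \<in> topspace Z. g z ` K \<subseteq> W}" by blast
  qed
qed

section \<open>Subbases and embeddings\<close>

lemma openin_if_continuous_map_id:
  assumes "continuous_map X Y id" "topspace Y \<subseteq> topspace X" "openin Y Q"
  shows "openin X Q"
proof -
  have "{x \<in> topspace X. id x \<in> Q} = Q" using assms(2) openin_subset[OF assms(3)] by auto
  then show ?thesis using openin_continuous_map_preimage[OF assms(1,3)] by simp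
qed

text \<open>The definition takes preimages of all open sets of the compact-open topologies;
  preimages of their subbasic sets generate the same topology, as the identity is continuous both
  ways. This brings the C^\<alpha>-topology into the form required by
  \<open>continuous_map_compact_open_generated\<close> and \<open>embedding_map_generated\<close>.
  \<open>S\<close> is inserted because \<open>I\<close> may be empty.\<close>

lemma initial_compact_open_eq_generated:
  assumes "\<And>i. i \<in> I \<Longrightarrow> f i \<in> S \<rightarrow> continuous_maps (X i) (Y i)"
  shows "initial_topology S I (\<lambda>i. compact_open_topology (X i) (Y i)) f =
    topology_generated_by
      (insert S {{s \<in> S. f i s ` K \<subseteq> W} |i K W. i \<in> I \<and> compactin (X i) K \<and> openin (Y i) W})"
    (is "?L = topology_generated_by ?G")
proof (rule topology_eq[THEN iffD2], intro allI iffI)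
  let ?R = "topology_generated_by ?G"
  have top: "topspace ?R = S" by auto
  have "continuous_map ?R ?L id"
  proof (rule continuous_map_initial_topology)
    fix i assume i: "i \<in> I"
    have "continuous_map ?R (compact_open_topology (X i) (Y i)) (f i)"
    proof (rule continuous_map_compact_open_topology)
      show "f i z \<in> continuous_maps (X i) (Y i)" if "z \<in> topspace ?R" for z
        using assms[OF i] that top by blast
      fix K W assume "compactin (X i) K" "openin (Y i) W"
      then have "{s \<in> S. f i s ` K \<subseteq> W} \<in> ?G" using i by blast
      then show "openin ?R {z \<in> topspace ?R. f i z ` K \<subseteq> W}"
        unfolding top by (rule topology_generated_by_Basis)
    qed
    then show "continuous_map ?R (compact_open_topology (X i) (Y i)) (\<lambda>z. f i (id z))" by simp
  qed (use top in auto)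
  show "openin ?R Q" if "openin ?L Q" for Q
    by (rule openin_if_continuous_map_id[OF \<open>continuous_map ?R ?L id\<close> _ that]) (simp only: top topspace_initial_topology subset_refl)
  have "continuous_map ?L ?R id"
  proof (rule continuous_on_generated_topo)
    fix Q assume "Q \<in> ?G"
    then consider "Q = S" |
      i K W where "i \<in> I" "compactin (X i) K" "openin (Y i) W" "Q = {s \<in> S. f i s ` K \<subseteq> W}"
      by blast
    then show "openin ?L (id -` Q \<inter> topspace ?L)"
    proof cases
      case 1
      then show ?thesis using openin_topspace[of ?L] by simp
    next
      case 2
      have "continuous_map ?L (compact_open_topology (X i) (Y i)) (f i)"
        using continuous_map_from_initial_topology[of i I f S "\<lambda>i. compact_open_topology (X i) (Y i)"] 2 assms[OF 2(1)]
        by simp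
      from openin_continuous_map_preimage[OF this openin_compact_open_topology[OF 2(2,3)]]
      have "openin ?L {x \<in> S. f i x \<in> {g \<in> continuous_maps (X i) (Y i). g ` K \<subseteq> W}}" by simp
      moreover have "{x \<in> S. f i x \<in> {g \<in> continuous_maps (X i) (Y i). g ` K \<subseteq> W}} = Q"
        using 2 assms[OF 2(1)] by auto
      moreover have "id -` Q \<inter> topspace ?L = Q" using 2 by auto
      ultimately show ?thesis by simp
    qed
  qed auto
  show "openin ?L Q" if "openin ?R Q" for Q
    by (rule openin_if_continuous_map_id[OF \<open>continuous_map ?L ?R id\<close> _ that]) (simp only: top topspace_initial_topology subset_refl)
qed

text \<open>The last assumption says that each subbasic set is open for the topology induced by
  \<open>f\<close>. This property passes to finite intersections and unions, hence to all open sets,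
  so \<open>f\<close> is open onto its image.\<close>

lemma embedding_map_generated:
  assumes cont: "continuous_map (topology_generated_by \<S>) Y f"
    and inj: "inj_on f (topspace (topology_generated_by \<S>))"
    and sub: "\<And>s x. \<lbrakk>s \<in> \<S>; x \<in> s\<rbrakk> \<Longrightarrow>
      \<exists>T. openin Y T \<and> f x \<in> T \<and> (\<forall>x'\<in>topspace (topology_generated_by \<S>). f x' \<in> T \<longrightarrow> x' \<in> s)"
  shows "embedding_map (topology_generated_by \<S>) Y f"
proof -
  let ?X = "topology_generated_by \<S>"
  let ?Y = "subtopology Y (f ` topspace ?X)"
  have op: "\<exists>T. openin Y T \<and> f x \<in> T \<and> (\<forall>x'\<in>topspace ?X. f x' \<in> T \<longrightarrow> x' \<in> Q)"
    if "generate_topology_on \<S> Q" "x \<in> Q" for Q x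
    using that
  proof (induction arbitrary: x rule: generate_topology_on.induct)
    case (Int a b)
    obtain T T' where "openin Y T" "f x \<in> T" "\<forall>x'\<in>topspace ?X. f x' \<in> T \<longrightarrow> x' \<in> a"
      "openin Y T'" "f x \<in> T'" "\<forall>x'\<in>topspace ?X. f x' \<in> T' \<longrightarrow> x' \<in> b"
      using Int.IH Int.prems by (metis IntD1 IntD2)
    then show ?case by (intro exI[of _ "T \<inter> T'"]) auto
  next
    case (UN K)
    then obtain k where k: "k \<in> K" "x \<in> k" by blast
    obtain T where "openin Y T" "f x \<in> T" "\<forall>x'\<in>topspace ?X. f x' \<in> T \<longrightarrow> x' \<in> k"
      using UN.IH[OF k] by blast
    then show ?case using k(1) by (intro exI[of _ T]) blast
  next
    case (Basis s)
    then show ?case by (rule sub)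
  qed simp
  have "open_map ?X ?Y f"
    unfolding open_map_def
  proof (intro allI impI)
    fix Q assume Q: "openin ?X Q"
    have QX: "Q \<subseteq> topspace ?X" using Q openin_subset by blast
    show "openin ?Y (f ` Q)"
    proof (subst openin_subopen, clarify)
      fix x assume x: "x \<in> Q"
      obtain T where T: "openin Y T" "f x \<in> T" "\<forall>x'\<in>topspace ?X. f x' \<in> T \<longrightarrow> x' \<in> Q"
        using op[OF openin_topology_generated_by[OF Q] x] by blast
      show "\<exists>T. openin ?Y T \<and> f x \<in> T \<and> T \<subseteq> f ` Q"
        using T x QX
        by (intro exI[of _ "T \<inter> f ` topspace ?X"] conjI openin_subtopology_Int) auto
    qed
  qed
  moreover have "continuous_map ?X ?Y f" using cont by (auto simp: continuous_map_in_subtopology)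
  moreover have "f ` topspace ?X = topspace ?Y"
    using cont by (auto simp: continuous_map_def)
  ultimately show ?thesis unfolding embedding_map_def
    using inj by (simp only: bijective_open_imp_homeomorphic_map)
qed

section \<open>Currying continuous maps on products\<close>

text \<open>Each point of \<open>M\<close> has an open rectangle inside \<open>W\<close>, and its
  sides are shrunk to compact neighbourhoods within the two projections of \<open>M\<close>. The
  resulting compact rectangles may leave \<open>M\<close>; an open \<open>W\<close> around
  \<open>M\<close> is what still confines them.\<close>

lemma compactin_prod_rectangle_cover:
  assumes X: "Hausdorff_space X" and Y: "Hausdorff_space Y"
    and M: "compactin (prod_topology X Y) M" and W: "openin (prod_topology X Y) W" and "M \<subseteq> W"
  shows "\<exists>\<R>. finite \<R> \<and>
    (\<forall>p\<in>\<R>. compactin X (fst p) \<and> compactin Y (snd p) \<and> fst p \<times> snd p \<subseteq> W) \<and>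
    M \<subseteq> (\<Union>p\<in>\<R>. fst p \<times> snd p)"
proof -
  let ?R = "\<lambda>P. \<exists>K L. compactin X K \<and> compactin Y L \<and> K \<times> L \<subseteq> W \<and> M \<inter> P \<subseteq> K \<times> L"
  have K0: "compactin X (fst ` M)" "compactin Y (snd ` M)"
    using image_compactin[OF M] continuous_map_fst continuous_map_snd by blast+
  have loc: "\<exists>P. openin (prod_topology X Y) P \<and> p \<in> P \<and> ?R P" if p: "p \<in> M" for p
  proof -
    have "(fst p, snd p) \<in> W" using p \<open>M \<subseteq> W\<close> by auto
    from W[unfolded openin_prod_topology_alt, rule_format, OF this]
    obtain Q1 Q2 where Q: "openin X Q1" "openin Y Q2" "fst p \<in> Q1" "snd p \<in> Q2" "Q1 \<times> Q2 \<subseteq> W"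
      by (elim exE conjE)
    have "openin (subtopology X (fst ` M)) (Q1 \<inter> fst ` M)" "fst p \<in> Q1 \<inter> fst ` M"
      using Q p by (auto intro: openin_subtopology_Int)
    then obtain P1 K where 1: "openin X P1" "fst p \<in> P1" "fst ` M \<inter> P1 \<subseteq> K"
        "K \<subseteq> Q1 \<inter> fst ` M" "compactin X K"
      by (rule compact_neighbourhood_within[OF X K0(1)])
    have "openin (subtopology Y (snd ` M)) (Q2 \<inter> snd ` M)" "snd p \<in> Q2 \<inter> snd ` M"
      using Q p by (auto intro: openin_subtopology_Int)
    then obtain P2 L where 2: "openin Y P2" "snd p \<in> P2" "snd ` M \<inter> P2 \<subseteq> L"
        "L \<subseteq> Q2 \<inter> snd ` M" "compactin Y L"
      by (rule compact_neighbourhood_within[OF Y K0(2)])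
    have "openin (prod_topology X Y) (P1 \<times> P2)" using 1 2 by (simp add: openin_prod_Times_iff)
    moreover have "p \<in> P1 \<times> P2" using 1 2 by (cases p) auto
    moreover have "K \<times> L \<subseteq> W" using 1 2 Q by blast
    moreover have "M \<inter> P1 \<times> P2 \<subseteq> K \<times> L" using 1(3) 2(3) by force
    ultimately show ?thesis using 1(5) 2(5) by blast
  qed
  have "\<exists>\<F>. finite \<F> \<and> (\<forall>P\<in>\<F>. ?R P) \<and> M \<subseteq> \<Union>\<F>"
    by (rule compactin_finite_cover[OF M]) (rule loc)
  then obtain \<F> where F: "finite \<F>" "\<forall>P\<in>\<F>. ?R P" "M \<subseteq> \<Union>\<F>" by (elim exE conjE)
  from F(2) obtain k l where kl: "\<And>P. P \<in> \<F> \<Longrightarrow> compactin X (k P) \<and> compactin Y (l P) \<and>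
      k P \<times> l P \<subseteq> W \<and> M \<inter> P \<subseteq> k P \<times> l P" by metis
  show ?thesis
  proof (intro exI conjI)
    show "finite ((\<lambda>P. (k P, l P)) ` \<F>)" using F by simp
    show "\<forall>p\<in>(\<lambda>P. (k P, l P)) ` \<F>. compactin X (fst p) \<and> compactin Y (snd p) \<and> fst p \<times> snd p \<subseteq> W"
      using kl by simp
    show "M \<subseteq> (\<Union>p\<in>(\<lambda>P. (k P, l P)) ` \<F>. fst p \<times> snd p)"
    proof
      fix p assume "p \<in> M"
      then obtain P where P: "P \<in> \<F>" "p \<in> M \<inter> P" using F(3) by blast
      then have "p \<in> k P \<times> l P" using kl[OF P(1)] by blast
      then show "p \<in> (\<Union>p\<in>(\<lambda>P. (k P, l P)) ` \<F>. fst p \<times> snd p)"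
        using P(1) by (intro UN_I[of "(k P, l P)"]) auto
    qed
  qed
qed

text \<open>The tube lemma (Wallace). It makes currying of a jointly continuous map continuous into
  the compact-open topology.\<close>

lemma openin_forall_compact:
  assumes f: "continuous_map (prod_topology X Y) E f" and L: "compactin Y L" and W: "openin E W"
  shows "openin X {x \<in> topspace X. \<forall>y\<in>L. f (x, y) \<in> W}"
proof (subst openin_subopen, clarify)
  fix x assume x: "x \<in> topspace X" "\<forall>y\<in>L. f (x, y) \<in> W"
  have op: "openin (prod_topology X Y) {p \<in> topspace (prod_topology X Y). f p \<in> W}"
    by (rule openin_continuous_map_preimage[OF f W])
  have sub: "{x} \<times> L \<subseteq> {p \<in> topspace (prod_topology X Y). f p \<in> W}"
    using x L compactin_subset_topspace by fastforce
  have "compactin X {x}" using x by simp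
  then obtain P Q where "openin X P" "openin Y Q" "{x} \<subseteq> P" "L \<subseteq> Q"
      "P \<times> Q \<subseteq> {p \<in> topspace (prod_topology X Y). f p \<in> W}"
    by (rule Wallace_theorem_prod_topology[OF _ L op sub])
  then show "\<exists>T. openin X T \<and> x \<in> T \<and> T \<subseteq> {x \<in> topspace X. \<forall>y\<in>L. f (x, y) \<in> W}"
    using openin_subset[of X P] by (intro exI[of _ P]) auto
qed

text \<open>
  Sequential argument: a sequence in \<open>Y\<close> together with its limit is compact, so the
  compact-open topology controls \<open>\<phi>\<close> on it.
\<close>

lemma continuous_map_uncurry_metrizable:
  assumes X: "metrizable_space X" and Y: "metrizable_space Y"
    and \<phi>: "continuous_map X (compact_open_topology Y E) \<phi>"
  shows "continuous_map (prod_topology X Y) E (\<lambda>(x, y). \<phi> x y)"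
proof -
  obtain M1 d1 where "Metric_space M1 d1" and X_eq: "X = Metric_space.mtopology M1 d1"
    using X unfolding metrizable_space_def by blast
  then interpret X: Metric_space M1 d1 by simp
  obtain M2 d2 where "Metric_space M2 d2" and Y_eq: "Y = Metric_space.mtopology M2 d2"
    using Y unfolding metrizable_space_def by blast
  then interpret Y: Metric_space M2 d2 by simp
  have mem: "\<phi> x \<in> continuous_maps Y E" if "x \<in> topspace X" for x
    using \<phi> that by (auto simp: continuous_map_def)
  have "openin (prod_topology X Y) {p \<in> topspace (prod_topology X Y). \<phi> (fst p) (snd p) \<in> W}"
    if W: "openin E W" for W
  proof (subst openin_subopen, clarify)
    fix x y assume "(x, y) \<in> topspace (prod_topology X Y)" and W': "\<phi> (fst (x, y)) (snd (x, y)) \<in> W"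
    then have x: "x \<in> M1" and y: "y \<in> M2" by (auto simp: X_eq Y_eq)
    have "openin Y {y \<in> topspace Y. \<phi> x y \<in> W}"
      using mem[of x] x W by (intro openin_continuous_map_preimage[of _ E]) (auto simp: X_eq continuous_maps_def)
    then obtain r where r: "r > 0" "Y.mball y r \<subseteq> {y \<in> topspace Y. \<phi> x y \<in> W}"
      using y W' unfolding Y_eq Y.openin_mtopology by auto
    \<comment> \<open>The radii \<open>r / Suc n\<close> do two things for the sequence
      \<open>v\<close> of a supposed counterexample: they tend to 0, so \<open>v\<close> converges
      to \<open>y\<close>, and they never exceed \<open>r\<close>, so \<open>\<phi> x\<close> maps
      the whole compact set \<open>insert y (range v)\<close> into \<open>W\<close>.\<close>
    have "\<exists>n::nat. X.mball x (1 / Suc n) \<times> Y.mball y (r / Suc n) \<subseteq>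
        {p \<in> topspace (prod_topology X Y). \<phi> (fst p) (snd p) \<in> W}"
    proof (rule ccontr)
      assume "\<not> ?thesis"
      then have "\<forall>n::nat. \<exists>u v. u \<in> X.mball x (1 / Suc n) \<and> v \<in> Y.mball y (r / Suc n) \<and> \<phi> u v \<notin> W"
        by (fastforce simp: X_eq Y_eq)
      then obtain u v where uv: "\<And>n::nat. u n \<in> X.mball x (1 / Suc n)"
          "\<And>n. v n \<in> Y.mball y (r / Suc n)" "\<And>n. \<phi> (u n) (v n) \<notin> W"
        by metis
      have dv: "d2 (v n) y < r / Suc n" "v n \<in> M2" for n
        using uv(2)[of n] by (auto simp: Y.commute)
      have "(\<lambda>n. r / real (Suc n)) \<longlonglongrightarrow> 0" using LIMSEQ_Suc[OF lim_const_over_n[of r]] by simp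
      then have "(\<lambda>n. d2 (v n) y) \<longlonglongrightarrow> 0"
        using dv(1)[THEN less_imp_le]
        by (intro tendsto_sandwich[of "\<lambda>_. 0" "\<lambda>n. d2 (v n) y" _ "\<lambda>n. r / Suc n"] always_eventually)
          (auto simp del: of_nat_Suc)
      then have "limitin Y v y sequentially"
        unfolding Y_eq Y.limitin_metric_dist_null using y dv by auto
      then have L: "compactin Y (insert y (range v))"
        by (rule compactin_sequence_with_limit) (use dv in \<open>auto simp: Y_eq\<close>)
      have "Y.mball y (r / Suc n) \<subseteq> Y.mball y r" for n
        using r(1) by (intro Y.mball_subset_concentric) (simp add: field_simps)
      then have "v n \<in> Y.mball y r" for n using uv(2) by blast
      moreover have "y \<in> Y.mball y r" using y r(1) by simp
      ultimately have "insert y (range v) \<subseteq> Y.mball y r" by blast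
      then have "\<phi> x \<in> {g \<in> continuous_maps Y E. g ` insert y (range v) \<subseteq> W}"
        using r(2) mem[of x] x by (force simp: X_eq simp del: Y.in_mball)
      moreover have "openin X {x \<in> topspace X. \<phi> x \<in> {g \<in> continuous_maps Y E. g ` insert y (range v) \<subseteq> W}}"
        by (rule openin_continuous_map_preimage[OF \<phi> openin_compact_open_topology[OF L W]])
      ultimately obtain s where s: "s > 0"
        "X.mball x s \<subseteq> {x \<in> topspace X. \<phi> x \<in> {g \<in> continuous_maps Y E. g ` insert y (range v) \<subseteq> W}}"
        using x unfolding X_eq X.openin_mtopology X.topspace_mtopology by blast
      \<comment> \<open>A single index is enough: once \<open>u n\<close> is within \<open>s\<close>
        of \<open>x\<close>, the map \<open>\<phi> (u n)\<close> sends all of \<open>range v\<close>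
        into \<open>W\<close>, in particular \<open>v n\<close>.\<close>
      obtain n where n: "inverse (real (Suc n)) < s" using reals_Archimedean s(1) by blast
      have "u n \<in> X.mball x s"
        using X.mball_subset_concentric[of "1 / Suc n" s x] uv(1)[of n] n by (auto simp: inverse_eq_divide)
      then have "\<phi> (u n) \<in> {g \<in> continuous_maps Y E. g ` insert y (range v) \<subseteq> W}" using s(2) by blast
      then show False using uv(3)[of n] by auto
    qed
    then obtain n :: nat where n: "X.mball x (1 / Suc n) \<times> Y.mball y (r / Suc n) \<subseteq>
        {p \<in> topspace (prod_topology X Y). \<phi> (fst p) (snd p) \<in> W}" by blast
    have "openin (prod_topology X Y) (X.mball x (1 / Suc n) \<times> Y.mball y (r / Suc n))"
      unfolding X_eq Y_eq by (simp add: openin_prod_Times_iff)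
    moreover have "(x, y) \<in> X.mball x (1 / Suc n) \<times> Y.mball y (r / Suc n)" using x y r(1) by simp
    ultimately show "\<exists>T. openin (prod_topology X Y) T \<and> (x, y) \<in> T \<and>
        T \<subseteq> {p \<in> topspace (prod_topology X Y). \<phi> (fst p) (snd p) \<in> W}"
      using n by blast
  qed
  moreover have "\<phi> x y \<in> topspace E" if "x \<in> topspace X" "y \<in> topspace Y" for x y
    using mem[OF that(1)] that(2) by (auto simp: continuous_maps_def continuous_map_def)
  ultimately show ?thesis by (simp add: continuous_map_def case_prod_unfold Pi_iff mem_Times_iff)
qed

subsection \<open>Uniqueness of continuous extensions\<close>

text \<open>In a T1 space the finitely many other points of a finite \<open>Q\<close> could be
  removed from an open set, which would isolate \<open>x\<close>.\<close>

lemma infinite_openin_no_isolated_points: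
  fixes S :: "'k::t1_space set"
  assumes "no_isolated_points S" and "openin (top_of_set S) Q" and "x \<in> Q"
  shows "infinite Q"
proof
  assume "finite Q"
  obtain T where T: "open T" "Q = S \<inter> T" using assms(2) by (auto simp: openin_open)
  have "open (T - (Q - {x}))" using T \<open>finite Q\<close> by (intro open_Diff finite_imp_closed) auto
  moreover have "(T - (Q - {x})) \<inter> S = {x}" using T \<open>x \<in> Q\<close> by auto
  ultimately have "x isolated_in S" using T \<open>x \<in> Q\<close> unfolding isolated_in_def by blast
  then show False using assms(1) by (simp add: no_isolated_points_def)
qed

text \<open>Coordinates are chosen one at a time, each avoiding the finitely many values already
  used.\<close>

lemma ex_inj_on_PiE:
  assumes "finite I" and "\<And>i. i \<in> I \<Longrightarrow> infinite (Q i)"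
  shows "\<exists>y\<in>PiE I Q. inj_on y I"
  using assms
proof (induction I)
  case empty
  then show ?case by simp
next
  case (insert i I)
  then obtain y where y: "y \<in> PiE I Q" "inj_on y I" by auto
  have "infinite (Q i - y ` I)" using insert by simp
  then obtain v where v: "v \<in> Q i" "v \<notin> y ` I" using infinite_imp_nonempty by blast
  have "y(i := v) \<in> PiE (insert i I) Q" using y v by (auto simp: PiE_def extensional_def)
  moreover have "inj_on (y(i := v)) (insert i I)"
    using y(2) v(2) insert.hyps(2) by (auto simp: inj_on_def)
  ultimately show ?case by blast
qed

lemma mem_multi_space:
  "x \<in> topspace (multi_space A \<beta>) \<longleftrightarrow>
    (\<forall>i j. if j \<le> \<beta> i then x (i, j) \<in> A i else x (i, j) = undefined)"
proof -
  have "x \<in> topspace (multi_space A \<beta>) \<longleftrightarrow>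
      (\<forall>p. if p \<in> (SIGMA i:UNIV. {0..\<beta> i}) then x p \<in> A (fst p) else x p = undefined)"
    by (auto simp: multi_space_def PiE_iff extensional_def case_prod_unfold split: if_splits)
  then show ?thesis by (simp add: split_paired_All)
qed

lemma continuous_map_into_multi_space:
  "continuous_map Z (multi_space A \<beta>) f \<longleftrightarrow>
    f \<in> topspace Z \<rightarrow> topspace (multi_space A \<beta>) \<and>
    (\<forall>i j. j \<le> \<beta> i \<longrightarrow> continuous_map Z (top_of_set (A i)) (\<lambda>z. f z (i, j)))"
  (is "?L \<longleftrightarrow> ?R")
proof
  assume L: ?L
  have "continuous_map Z (top_of_set (A i)) (\<lambda>z. f z (i, j))" if "j \<le> \<beta> i" for i j
    using L[unfolded multi_space_def continuous_map_componentwise] that by auto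
  with L show ?R by (simp add: continuous_map_def[of Z "multi_space A \<beta>"])
next
  assume R: ?R
  then have "f \<in> topspace Z \<rightarrow> extensional (SIGMA i:UNIV. {0..\<beta> i})"
    by (auto simp: Pi_iff mem_multi_space extensional_def)
  with R show ?L by (auto simp: multi_space_def continuous_map_componentwise Pi_iff)
qed

lemma continuous_map_multi_space_component:
  "j \<le> \<beta> i \<Longrightarrow> continuous_map (multi_space A \<beta>) (top_of_set (A i)) (\<lambda>x. x (i, j))"
  by (rule continuous_map_into_multi_space[THEN iffD1, OF continuous_map_id[unfolded id_def],
        THEN conjunct2, rule_format])

lemma Hausdorff_multi_space: "Hausdorff_space (multi_space (A :: _ \<Rightarrow> 'k::t2_space set) \<beta>)"
proof -
  have "Hausdorff_space (euclidean :: 'k topology)"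
    unfolding Hausdorff_space_def disjnt_def using hausdorff by auto
  then show ?thesis
    by (simp add: multi_space_def Hausdorff_space_product_topology Hausdorff_space_subtopology case_prod_unfold)
qed

lemma metrizable_multi_space:
  fixes A :: "'n::finite \<Rightarrow> 'k::topological_space set"
  assumes "metrizable_space (euclidean :: 'k topology)"
  shows "metrizable_space (multi_space A \<beta>)"
proof -
  have "countable (SIGMA i:UNIV. {0..\<beta> i})" by (intro countable_finite finite_SigmaI) auto
  then show ?thesis unfolding multi_space_def
    using assms
    by (auto simp: metrizable_space_product_topology metrizable_space_subtopology
        intro: countable_subset[rotated] split: prod.split)
qed

text \<open>A basic neighbourhood is a box whose sides are nonempty and relatively open in sets
  without isolated points, hence infinite. A point of the box with all coordinates different, even
  across blocks, then exists.\<close>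

lemma multi_distinct_dense:
  fixes A :: "'n::finite \<Rightarrow> 'k::t1_space set"
  assumes A: "\<And>i. no_isolated_points (A i)" and x: "x \<in> topspace (multi_space A \<beta>)"
  shows "x \<in> multi_space A \<beta> closure_of multi_distinct A \<beta>"
  unfolding in_closure_of
proof (intro conjI allI impI x)
  fix T assume T: "x \<in> T \<and> openin (multi_space A \<beta>) T"
  let ?I = "SIGMA i:UNIV. {0..\<beta> i}"
  obtain Q where Q: "\<And>p. p \<in> ?I \<Longrightarrow> openin ((\<lambda>(i, j). top_of_set (A i)) p) (Q p)"
      "x \<in> PiE ?I Q" "PiE ?I Q \<subseteq> T"
    using T[THEN conjunct2, unfolded multi_space_def openin_product_topology_alt, rule_format, OF conjunct1[OF T]]
    by (elim exE conjE) blast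
  have inf: "infinite (Q p)" if p: "p \<in> ?I" for p
    using infinite_openin_no_isolated_points[OF A, of "fst p" "Q p" "x p"] Q(1)[OF p] Q(2) p
    by (auto simp: case_prod_unfold)
  have "finite ?I" by (intro finite_SigmaI) auto
  then have "\<exists>y\<in>PiE ?I Q. inj_on y ?I" by (rule ex_inj_on_PiE) (rule inf)
  then obtain y where y: "y \<in> PiE ?I Q" "inj_on y ?I" by (elim bexE)
  have "y \<in> T" using y Q by blast
  then have "y \<in> topspace (multi_space A \<beta>)" using T openin_subset by blast
  moreover have "y (i, j) \<noteq> y (i, k)" if "j < k" "k \<le> \<beta> i" for i j k
    using inj_onD[OF y(2), of "(i, j)" "(i, k)"] that by auto
  ultimately have "y \<in> multi_distinct A \<beta>" by (simp add: multi_distinct_def)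
  with \<open>y \<in> T\<close> show "\<exists>y. y \<in> multi_distinct A \<beta> \<and> y \<in> T" by blast
qed

lemma is_diff_ext_unique:
  assumes "Hausdorff_space E" "\<And>i. no_isolated_points (A i)"
    and g: "is_diff_ext smul E A \<beta> f g" and h: "is_diff_ext smul E A \<beta> f h"
  shows "g = h"
proof (rule extensionalityI)
  show "g \<in> extensional (topspace (multi_space A \<beta>))" "h \<in> extensional (topspace (multi_space A \<beta>))"
    using g h by (auto simp: is_diff_ext_def continuous_maps_def)
  fix x assume x: "x \<in> topspace (multi_space A \<beta>)"
  have "continuous_map (multi_space A \<beta>) E g" "continuous_map (multi_space A \<beta>) E h"
    and "\<And>x. x \<in> multi_distinct A \<beta> \<Longrightarrow> g x = h x"
    using g h by (auto simp: is_diff_ext_def continuous_maps_def)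
  then show "g x = h x"
    by (rule forall_in_closure_of_eq[OF multi_distinct_dense[OF assms(2) x] assms(1)])
qed

lemma diff_ext_eqI:
  assumes "Hausdorff_space E" "\<And>i. no_isolated_points (A i)" "is_diff_ext smul E A \<beta> f g"
  shows "diff_ext smul E A \<beta> f = g"
  unfolding diff_ext_def by (rule the_equality, rule assms(3), rule is_diff_ext_unique[OF assms(1,2) _ assms(3)])

lemma is_diff_ext_diff_ext:
  assumes "Hausdorff_space E" "C_map smul E \<alpha> U f" "A \<in> cartesian_open_factors U"
    "\<And>i. enat (\<beta> i) \<le> \<alpha> i"
  shows "is_diff_ext smul E A \<beta> f (diff_ext smul E A \<beta> f)"
proof -
  obtain g where g: "is_diff_ext smul E A \<beta> f g" using assms unfolding C_map_def by blast
  moreover have "\<And>i. no_isolated_points (A i)"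
    using assms(3) by (auto simp: cartesian_open_factors_def)
  ultimately show ?thesis using diff_ext_eqI[OF assms(1), of A smul \<beta> f g] by simp
qed

subsection \<open>Concatenation of multi-points\<close>

text \<open>On multi-points this is the homeomorphism from \<open>U^<a> x V^<b>\<close> to
  \<open>(U x V)^<(a,b)>\<close>, with inverse \<open>multi_split\<close> below.\<close>

definition multi_append :: "('n \<times> nat \<Rightarrow> 'k) \<Rightarrow> ('m \<times> nat \<Rightarrow> 'k) \<Rightarrow> ('n + 'm) \<times> nat \<Rightarrow> 'k" where
  "multi_append x y = (\<lambda>(i, j). case i of Inl a \<Rightarrow> x (a, j) | Inr b \<Rightarrow> y (b, j))"

lemma multi_append_simps [simp]:
  "multi_append x y (Inl a, j) = x (a, j)" "multi_append x y (Inr b, j) = y (b, j)"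
  by (simp_all add: multi_append_def)

lemma multi_append_in_topspace_iff [simp]:
  "multi_append x y \<in> topspace (multi_space (case_sum A B) (case_sum a b)) \<longleftrightarrow>
    x \<in> topspace (multi_space A a) \<and> y \<in> topspace (multi_space B b)"
  by (simp add: mem_multi_space split_sum_all)

lemma multi_append_in_multi_distinct_iff:
  "multi_append x y \<in> multi_distinct (case_sum A B) (case_sum a b) \<longleftrightarrow>
    x \<in> multi_distinct A a \<and> y \<in> multi_distinct B b"
  by (auto simp: multi_distinct_def split_sum_all)

lemma continuous_map_multi_append:
  "continuous_map (prod_topology (multi_space A a) (multi_space B b))
    (multi_space (case_sum A B) (case_sum a b)) (\<lambda>(x, y). multi_append x y)"
  unfolding continuous_map_into_multi_space
proof (intro conjI allI impI)
  fix i j assume j: "j \<le> case_sum a b i"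
  show "continuous_map (prod_topology (multi_space A a) (multi_space B b)) (top_of_set (case_sum A B i))
     (\<lambda>z. (case z of (x, y) \<Rightarrow> multi_append x y) (i, j))"
  proof (cases i)
    case (Inl k)
    then have "continuous_map (prod_topology (multi_space A a) (multi_space B b)) (top_of_set (A k))
       ((\<lambda>x. x (k, j)) \<circ> fst)"
      using j by (intro continuous_map_compose[OF continuous_map_fst] continuous_map_multi_space_component) auto
    then show ?thesis using Inl by (simp add: comp_def case_prod_unfold)
  next
    case (Inr k)
    then have "continuous_map (prod_topology (multi_space A a) (multi_space B b)) (top_of_set (B k))
       ((\<lambda>x. x (k, j)) \<circ> snd)"
      using j by (intro continuous_map_compose[OF continuous_map_snd] continuous_map_multi_space_component) auto
    then show ?thesis using Inr by (simp add: comp_def case_prod_unfold)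
  qed
qed auto

lemma continuous_map_multi_append_left:
  "y \<in> topspace (multi_space B b) \<Longrightarrow>
    continuous_map (multi_space A a) (multi_space (case_sum A B) (case_sum a b)) (\<lambda>x. multi_append x y)"
  using continuous_map_compose[OF _ continuous_map_multi_append,
      of "multi_space A a" A a B b "\<lambda>x. (x, y)"]
  by (simp add: comp_def continuous_map_pairwise)

lemma continuous_map_multi_append_right:
  "x \<in> topspace (multi_space A a) \<Longrightarrow>
    continuous_map (multi_space B b) (multi_space (case_sum A B) (case_sum a b)) (multi_append x)"
  using continuous_map_compose[OF _ continuous_map_multi_append,
      of "multi_space B b" A a B b "\<lambda>y. (x, y)"]
  by (simp add: comp_def continuous_map_pairwise)

definition multi_split :: "(('n + 'm) \<times> nat \<Rightarrow> 'k) \<Rightarrow> ('n \<times> nat \<Rightarrow> 'k) \<times> ('m \<times> nat \<Rightarrow> 'k)" where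
  "multi_split z = ((\<lambda>(i, j). z (Inl i, j)), (\<lambda>(i, j). z (Inr i, j)))"

lemma multi_append_multi_split [simp]: "multi_append (fst (multi_split z)) (snd (multi_split z)) = z"
  by (auto simp: multi_append_def multi_split_def fun_eq_iff split: sum.split)

lemma continuous_map_multi_split:
  "continuous_map (multi_space (case_sum A B) (case_sum a b))
    (prod_topology (multi_space A a) (multi_space B b)) multi_split"
proof -
  let ?Z = "multi_space (case_sum A B) (case_sum a b)"
  have "continuous_map ?Z (multi_space A a) (\<lambda>z (i, j). z (Inl i, j))"
    unfolding continuous_map_into_multi_space
  proof (intro conjI allI impI)
    fix i j assume "j \<le> a i"
    then show "continuous_map ?Z (top_of_set (A i)) (\<lambda>z. (case (i, j) of (i, j) \<Rightarrow> z (Inl i, j)))"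
      using continuous_map_multi_space_component[of j "case_sum a b" "Inl i" "case_sum A B"] by simp
  qed (auto simp: mem_multi_space split_sum_all)
  moreover have "continuous_map ?Z (multi_space B b) (\<lambda>z (i, j). z (Inr i, j))"
    unfolding continuous_map_into_multi_space
  proof (intro conjI allI impI)
    fix i j assume "j \<le> b i"
    then show "continuous_map ?Z (top_of_set (B i)) (\<lambda>z. (case (i, j) of (i, j) \<Rightarrow> z (Inr i, j)))"
      using continuous_map_multi_space_component[of j "case_sum a b" "Inr i" "case_sum A B"] by simp
  qed (auto simp: mem_multi_space split_sum_all)
  ultimately show ?thesis
    by (simp add: continuous_map_pairwise multi_split_def comp_def)
qed

lemma prod_UNIV_sum:
  fixes g :: "'n::finite + 'm::finite \<Rightarrow> 'a::comm_monoid_mult"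
  shows "prod g UNIV = (\<Prod>i\<in>UNIV. g (Inl i)) * (\<Prod>i\<in>UNIV. g (Inr i))"
  by (simp add: UNIV_Plus_UNIV[symmetric] prod.Plus del: UNIV_Plus_UNIV)

text \<open>A multi-index over the sum type is a pair of multi-indices, and its coefficient is the
  product of the two coefficients because only entries of the same block are ever subtracted. The
  quotient in \<open>x\<close> is put inside: as a function of \<open>v\<close> it is the value of
  the quotient of the curried map.\<close>

lemma diff_quot_multi_append:
  fixes a :: "'n::finite \<Rightarrow> nat" and b :: "'m::finite \<Rightarrow> nat"
  assumes "vector_space smul"
  shows "diff_quot smul (case_sum a b) f (multi_append x y) =
    diff_quot smul b (\<lambda>v. diff_quot smul a (\<lambda>u. f (vec_append u v)) x) y"
proof -
  interpret vector_space smul by fact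
  let ?J = "{j. \<forall>i. j i \<le> case_sum a b i}"
  let ?a = "{j. \<forall>i. j i \<le> a i}" and ?b = "{j. \<forall>i. j i \<le> b i}"
  define z where "z = multi_append x y"
  define c where "c j = (\<Prod>i\<in>UNIV. \<Prod>k\<in>{0..case_sum a b i} - {j i}. 1 / (z (i, j i) - z (i, k)))" for j
  define ca where "ca j = (\<Prod>i\<in>UNIV. \<Prod>k\<in>{0..a i} - {j i}. 1 / (x (i, j i) - x (i, k)))" for j
  define cb where "cb j = (\<Prod>i\<in>UNIV. \<Prod>k\<in>{0..b i} - {j i}. 1 / (y (i, j i) - y (i, k)))" for j
  have c: "c (case_sum p q) = cb q * ca p" for p q
    by (simp add: c_def ca_def cb_def z_def prod_UNIV_sum mult.commute)
  have v: "(\<chi> i. z (i, case_sum p q i)) = vec_append (\<chi> i. x (i, p i)) (\<chi> i. y (i, q i))" for p q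
    by (auto simp: vec_append_def z_def vec_eq_iff split: sum.split)
  have "diff_quot smul (case_sum a b) f z = (\<Sum>j\<in>?J. smul (c j) (f (\<chi> i. z (i, j i))))"
    by (simp add: diff_quot_def c_def)
  also have "\<dots> = (\<Sum>(q, p)\<in>?b \<times> ?a. smul (c (case_sum p q)) (f (\<chi> i. z (i, case_sum p q i))))"
    by (rule sum.reindex_bij_witness[where i = "\<lambda>(q, p). case_sum p q" and j = "\<lambda>j. (j \<circ> Inr, j \<circ> Inl)"])
      (auto simp: split_sum_all case_sum_o_inj surjective_sum comp_def split: sum.split)
  also have "\<dots> = (\<Sum>q\<in>?b. \<Sum>p\<in>?a. smul (c (case_sum p q)) (f (\<chi> i. z (i, case_sum p q i))))"
    by (rule sum.cartesian_product[symmetric])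
  also have "\<dots> = (\<Sum>q\<in>?b. smul (cb q) (\<Sum>p\<in>?a. smul (ca p)
      (f (vec_append (\<chi> i. x (i, p i)) (\<chi> i. y (i, q i))))))"
    by (simp add: c v scale_sum_right)
  also have "\<dots> = diff_quot smul b (\<lambda>v. diff_quot smul a (\<lambda>u. f (vec_append u v)) x) y"
    by (simp add: diff_quot_def ca_def cb_def)
  finally show ?thesis by (simp add: z_def)
qed

text \<open>Evaluation at \<open>v\<close> is linear, so it passes through the finite sum; quotients
  of function-valued maps are thereby computed pointwise.\<close>

lemma diff_quot_fun_scale_apply:
  fixes a :: "'n::finite \<Rightarrow> nat" and h :: "'k::field ^ 'n \<Rightarrow> 'v \<Rightarrow> 'e::ab_group_add"
  shows "diff_quot (fun_scale smul) a h x v = diff_quot smul a (\<lambda>u. h u v) x"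
proof -
  have "(\<Sum>j\<in>J. F j) v = (\<Sum>j\<in>J. F j v)" for J and F :: "('n \<Rightarrow> nat) \<Rightarrow> 'v \<Rightarrow> 'e"
    by (induction J rule: infinite_finite_induct) auto
  then show ?thesis by (simp add: diff_quot_def fun_scale_def)
qed

lemma diff_quot_0:
  fixes f :: "'k::field ^ 'n::finite \<Rightarrow> 'e::ab_group_add"
  assumes "vector_space smul"
  shows "diff_quot smul (\<lambda>_. 0) f x = f (\<chi> i. x (i, 0))"
proof -
  interpret vector_space smul by fact
  have "{j :: 'n \<Rightarrow> nat. \<forall>i. j i = 0} = {\<lambda>_. 0}" by auto
  then show ?thesis by (simp add: diff_quot_def)
qed

subsection \<open>Products of locally cartesian sets\<close>

lemma vec_append_nth [simp]:
  "vec_append x y $ Inl i = x $ i" "vec_append x y $ Inr j = y $ j"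
  by (simp_all add: vec_append_def)

lemma vec_append_eq_iff [simp]: "vec_append x y = vec_append x' y' \<longleftrightarrow> x = x' \<and> y = y'"
  by (auto simp: vec_eq_iff split_sum_all)

lemma vec_append_vec_lambda [simp]: "vec_append (\<chi> i. z $ Inl i) (\<chi> i. z $ Inr i) = z"
  by (simp add: vec_eq_iff split_sum_all)

lemma vec_append_cases: obtains x y where "z = vec_append x y"
  using vec_append_vec_lambda[of z] by metis

lemma vec_append_in_vec_Times_iff [simp]: "vec_append x y \<in> vec_Times U V \<longleftrightarrow> x \<in> U \<and> y \<in> V"
  by (auto simp: vec_Times_def)

lemma vec_append_in_box_of_iff: "vec_append x y \<in> box_of C \<longleftrightarrow> x \<in> box_of (C \<circ> Inl) \<and> y \<in> box_of (C \<circ> Inr)"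
  by (simp add: box_of_def split_sum_all)

lemma continuous_on_vec_append:
  assumes "continuous_on S f" "continuous_on S g"
  shows "continuous_on S (\<lambda>x. vec_append (f x) (g x) :: 'k::topological_space ^ ('n::finite + 'm::finite))"
  unfolding vec_append_def
proof (rule continuous_on_vec_lambda)
  fix i :: "'n + 'm"
  show "continuous_on S (\<lambda>x. case i of Inl a \<Rightarrow> f x $ a | Inr b \<Rightarrow> g x $ b)"
    using assms by (cases i) (auto intro: continuous_on_component)
qed

lemma cartesian_open_factors_no_isolated_points:
  "A \<in> cartesian_open_factors U \<Longrightarrow> no_isolated_points (A i)"
  by (simp add: cartesian_open_factors_def)

lemma cartesian_open_factors_subset: "A \<in> cartesian_open_factors U \<Longrightarrow> box_of A \<subseteq> U"
  using openin_subset[of "top_of_set U" "box_of A"] by (simp add: cartesian_open_factors_def)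

lemma cartesian_open_factors_vec_Times:
  fixes A :: "'n::finite \<Rightarrow> 'k::topological_space set" and B :: "'m::finite \<Rightarrow> 'k set"
  assumes A: "A \<in> cartesian_open_factors U" and B: "B \<in> cartesian_open_factors V"
  shows "case_sum A B \<in> cartesian_open_factors (vec_Times U V)"
proof -
  obtain P where P: "open P" "box_of A = U \<inter> P"
    using A by (auto simp: cartesian_open_factors_def openin_open)
  obtain Q where Q: "open Q" "box_of B = V \<inter> Q"
    using B by (auto simp: cartesian_open_factors_def openin_open)
  let ?O = "((\<lambda>z. \<chi> i. z $ Inl i) -` P \<inter> (\<lambda>z. \<chi> i. z $ Inr i) -` Q) :: ('k ^ ('n + 'm)) set"
  have "open ?O"
    using P(1) Q(1) by (intro open_Int open_vimage continuous_on_vec_lambda continuous_on_component continuous_on_id)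
  moreover have "box_of (case_sum A B) = vec_Times U V \<inter> ?O"
  proof (rule set_eqI)
    fix z :: "'k ^ ('n + 'm)"
    show "z \<in> box_of (case_sum A B) \<longleftrightarrow> z \<in> vec_Times U V \<inter> ?O"
    proof (cases z rule: vec_append_cases)
      case (1 x y)
      have "z \<in> box_of (case_sum A B) \<longleftrightarrow> x \<in> U \<inter> P \<and> y \<in> V \<inter> Q"
        using P(2) Q(2) by (simp add: 1 vec_append_in_box_of_iff case_sum_o_inj)
      moreover have "(\<chi> i. z $ Inl i) = x" "(\<chi> i. z $ Inr i) = y" by (simp_all add: 1 vec_eq_iff)
      ultimately show ?thesis by (auto simp: 1)
    qed
  qed
  ultimately have "openin (top_of_set (vec_Times U V)) (box_of (case_sum A B))"
    by (auto simp: openin_open)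
  then show ?thesis
    using A B by (simp add: cartesian_open_factors_def split_sum_all)
qed

text \<open>Through a point of the box, each factor box is a slice of the product box, and slices of
  relatively open sets are relatively open. An empty product box would say nothing about its
  factors, hence the nonemptiness assumption.\<close>

lemma cartesian_open_factors_vec_Times_components:
  fixes C :: "'n::finite + 'm::finite \<Rightarrow> 'k::topological_space set"
  assumes C: "C \<in> cartesian_open_factors (vec_Times U V)" and "box_of C \<noteq> {}"
  shows "C \<circ> Inl \<in> cartesian_open_factors U" "C \<circ> Inr \<in> cartesian_open_factors V"
proof -
  obtain z where "z \<in> box_of C" using assms(2) by auto
  moreover obtain x0 y0 where "z = vec_append x0 y0" by (rule vec_append_cases)
  ultimately have box: "x0 \<in> box_of (C \<circ> Inl)" "y0 \<in> box_of (C \<circ> Inr)" "vec_append x0 y0 \<in> box_of C"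
    by (auto simp: vec_append_in_box_of_iff)
  obtain T where T: "open T" "box_of C = vec_Times U V \<inter> T"
    using C by (auto simp: cartesian_open_factors_def openin_open)
  have UV: "x0 \<in> U" "y0 \<in> V" using box(3) T by auto
  have "x \<in> box_of (C \<circ> Inl) \<longleftrightarrow> x \<in> U \<and> vec_append x y0 \<in> T" for x
    using T(2) UV box(2) vec_append_in_box_of_iff[of x y0 C] by (auto simp: set_eq_iff)
  then have 1: "box_of (C \<circ> Inl) = U \<inter> (\<lambda>x. vec_append x y0) -` T" by auto
  have "y \<in> box_of (C \<circ> Inr) \<longleftrightarrow> y \<in> V \<and> vec_append x0 y \<in> T" for y
    using T(2) UV box(1) vec_append_in_box_of_iff[of x0 y C] by (auto simp: set_eq_iff)
  then have 2: "box_of (C \<circ> Inr) = V \<inter> vec_append x0 -` T" by auto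
  have "open ((\<lambda>x. vec_append x y0) -` T)" "open (vec_append x0 -` T)"
    using T(1) by (auto intro!: open_vimage continuous_on_vec_append continuous_on_id continuous_on_const)
  then show "C \<circ> Inl \<in> cartesian_open_factors U" "C \<circ> Inr \<in> cartesian_open_factors V"
    using C 1 2 by (auto simp: cartesian_open_factors_def openin_open)
qed

lemma locally_cartesian_factors:
  assumes "locally_cartesian U" "x \<in> U"
  obtains A where "A \<in> cartesian_open_factors U" "x \<in> box_of A"
proof -
  obtain W where W: "x \<in> W" "openin (top_of_set U) W" "cartesian W"
    using assms unfolding locally_cartesian_def by blast
  then obtain A where "\<forall>i. no_isolated_points (A i)" "W = box_of A" unfolding cartesian_def by blast
  with W show thesis by (intro that[of A]) (simp_all add: cartesian_open_factors_def)
qed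

lemma multi_space_point_in_box_of:
  "x \<in> topspace (multi_space A a) \<Longrightarrow> \<forall>i. j i \<le> a i \<Longrightarrow> (\<chi> i. x (i, j i)) \<in> box_of A"
  by (auto simp: mem_multi_space box_of_def split: if_splits)

text \<open>The point \<open>v\<close> as an element of \<open>U^<0>\<close>;
  \<open>undefined\<close> is forced by the extensionality of product spaces. At such points a
  quotient of order 0 returns the value of the map, which is how values are recovered from
  extensions.\<close>

definition point_0 :: "'k ^ 'n \<Rightarrow> 'n \<times> nat \<Rightarrow> 'k" where
  "point_0 v = (\<lambda>(i, j). if j = 0 then v $ i else undefined)"

lemma vec_lambda_point_0 [simp]: "(\<chi> i. point_0 v (i, 0)) = v"
  by (simp add: point_0_def)

lemma point_0_in_multi_distinct: "v \<in> box_of A \<Longrightarrow> point_0 v \<in> multi_distinct A (\<lambda>_. 0)"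
  by (auto simp: multi_distinct_def mem_multi_space point_0_def box_of_def)

lemma multi_distinct_subset: "multi_distinct A a \<subseteq> topspace (multi_space A a)"
  by (auto simp: multi_distinct_def)

subsection \<open>The topology of \<open>C\<^sup>\<alpha>\<close>-spaces\<close>

lemma mem_C_space:
  "f \<in> topspace (C_space smul E \<alpha> U) \<longleftrightarrow> C_map smul E \<alpha> U f \<and> (\<forall>x. x \<notin> U \<longrightarrow> f x = 0)"
  by (simp add: C_space_def)

definition C_indices :: "('n \<Rightarrow> enat) \<Rightarrow> ('k::topological_space ^ 'n) set \<Rightarrow> (('n \<Rightarrow> 'k set) \<times> ('n \<Rightarrow> nat)) set" where
  "C_indices \<alpha> U = {(A, \<beta>). A \<in> cartesian_open_factors U \<and> (\<forall>i. enat (\<beta> i) \<le> \<alpha> i)}"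

lemma C_indices_iff: "(A, \<beta>) \<in> C_indices \<alpha> U \<longleftrightarrow> A \<in> cartesian_open_factors U \<and> (\<forall>i. enat (\<beta> i) \<le> \<alpha> i)"
  by (simp add: C_indices_def)

lemma C_space_eq_initial:
  "C_space smul E \<alpha> U =
    initial_topology (topspace (C_space smul E \<alpha> U)) (C_indices \<alpha> U)
      (\<lambda>p. compact_open_topology (multi_space (fst p) (snd p)) E)
      (\<lambda>p. diff_ext smul E (fst p) (snd p))"
  by (simp add: C_space_def C_indices_def case_prod_unfold)

lemma diff_ext_is_diff_ext:
  assumes "Hausdorff_space E" "f \<in> topspace (C_space smul E \<alpha> U)"
    "A \<in> cartesian_open_factors U" "\<And>i. enat (\<beta> i) \<le> \<alpha> i"
  shows "is_diff_ext smul E A \<beta> f (diff_ext smul E A \<beta> f)"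
  using assms by (intro is_diff_ext_diff_ext) (auto simp: mem_C_space)

lemma C_space_eq_generated:
  assumes "Hausdorff_space E"
  shows "C_space smul E \<alpha> U = topology_generated_by (insert (topspace (C_space smul E \<alpha> U))
     {{f \<in> topspace (C_space smul E \<alpha> U). diff_ext smul E (fst p) (snd p) f ` K \<subseteq> W} |p K W.
       p \<in> C_indices \<alpha> U \<and> compactin (multi_space (fst p) (snd p)) K \<and> openin E W})"
proof (rule trans[OF C_space_eq_initial], rule initial_compact_open_eq_generated)
  fix p assume "p \<in> C_indices \<alpha> U"
  then show "diff_ext smul E (fst p) (snd p) \<in> topspace (C_space smul E \<alpha> U) \<rightarrow>
      continuous_maps (multi_space (fst p) (snd p)) E"
    using diff_ext_is_diff_ext[OF assms, of _ smul \<alpha> U "fst p" "snd p"]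
    by (cases p) (auto simp: is_diff_ext_def C_indices_iff)
qed

lemma diff_ext_in_continuous_maps:
  assumes "Hausdorff_space E" "A \<in> cartesian_open_factors U" "\<And>i. enat (\<beta> i) \<le> \<alpha> i"
    "f \<in> topspace (C_space smul E \<alpha> U)"
  shows "diff_ext smul E A \<beta> f \<in> continuous_maps (multi_space A \<beta>) E"
  using diff_ext_is_diff_ext[OF assms(1,4,2,3)] by (simp add: is_diff_ext_def)

lemma continuous_map_diff_ext:
  assumes "Hausdorff_space E" "A \<in> cartesian_open_factors U" "\<And>i. enat (\<beta> i) \<le> \<alpha> i"
  shows "continuous_map (C_space smul E \<alpha> U) (compact_open_topology (multi_space A \<beta>) E) (diff_ext smul E A \<beta>)"
proof -
  have "diff_ext smul E A \<beta> \<in> topspace (C_space smul E \<alpha> U) \<rightarrow> continuous_maps (multi_space A \<beta>) E"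
    using diff_ext_in_continuous_maps[OF assms] by auto
  moreover have "(A, \<beta>) \<in> C_indices \<alpha> U" using assms(2,3) by (simp add: C_indices_iff)
  ultimately show ?thesis
    using continuous_map_from_initial_topology[of "(A, \<beta>)" "C_indices \<alpha> U"
        "\<lambda>p. diff_ext smul E (fst p) (snd p)" "topspace (C_space smul E \<alpha> U)"
        "\<lambda>p. compact_open_topology (multi_space (fst p) (snd p)) E"]
    unfolding C_space_eq_initial[symmetric] by simp
qed

lemma openin_C_space:
  assumes "Hausdorff_space E" "A \<in> cartesian_open_factors U" "\<And>i. enat (\<beta> i) \<le> \<alpha> i"
    and "compactin (multi_space A \<beta>) K" "openin E W"
  shows "openin (C_space smul E \<alpha> U) {f \<in> topspace (C_space smul E \<alpha> U). diff_ext smul E A \<beta> f ` K \<subseteq> W}"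
proof -
  have "{f \<in> topspace (C_space smul E \<alpha> U). diff_ext smul E A \<beta> f ` K \<subseteq> W} =
      {f \<in> topspace (C_space smul E \<alpha> U). diff_ext smul E A \<beta> f \<in>
        {g \<in> continuous_maps (multi_space A \<beta>) E. g ` K \<subseteq> W}}"
    using diff_ext_in_continuous_maps[OF assms(1-3)] by auto
  then show ?thesis
    using openin_continuous_map_preimage[OF continuous_map_diff_ext[OF assms(1-3)]
        openin_compact_open_topology[OF assms(4,5)]]
    by simp
qed

lemma continuous_map_into_C_space:
  assumes "Hausdorff_space E" "\<And>z. z \<in> topspace Z \<Longrightarrow> g z \<in> topspace (C_space smul E \<alpha> U)"
    and "\<And>A \<beta>. \<lbrakk>A \<in> cartesian_open_factors U; \<And>i. enat (\<beta> i) \<le> \<alpha> i\<rbrakk> \<Longrightarrow>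
      continuous_map Z (compact_open_topology (multi_space A \<beta>) E) (\<lambda>z. diff_ext smul E A \<beta> (g z))"
  shows "continuous_map Z (C_space smul E \<alpha> U) g"
proof (subst C_space_eq_initial, rule continuous_map_initial_topology)
  fix p assume "p \<in> C_indices \<alpha> U"
  then show "continuous_map Z (compact_open_topology (multi_space (fst p) (snd p)) E)
      (\<lambda>z. diff_ext smul E (fst p) (snd p) (g z))"
    by (cases p) (auto simp: C_indices_iff intro: assms(3))
qed (use assms(2) in auto)

lemma diff_ext_0_point:
  assumes "vector_space smul" "is_diff_ext smul E A (\<lambda>_. 0) f g" "v \<in> box_of A"
  shows "g (point_0 v) = f v"
  using assms(2) point_0_in_multi_distinct[OF assms(3)] diff_quot_0[OF assms(1), of f "point_0 v"]
  by (simp add: is_diff_ext_def)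

text \<open>Evaluation at a point is the order-0 quotient at the compact set
  \<open>{point_0 x}\<close>, hence continuous, and evaluations separate maps. The result is needed
  because C^\<beta>(V,E) serves as a target space, where uniqueness of extensions relies on the
  Hausdorff property.\<close>

lemma Hausdorff_C_space:
  fixes smul :: "'k::topological_field \<Rightarrow> 'e::ab_group_add \<Rightarrow> 'e"
  assumes "vector_space smul" "Hausdorff_space E" "locally_cartesian U"
  shows "Hausdorff_space (C_space smul E \<alpha> U)"
  unfolding Hausdorff_space_def
proof (intro allI impI, elim conjE)
  let ?D = "C_space smul E \<alpha> U"
  fix f g assume fg: "f \<in> topspace ?D" "g \<in> topspace ?D" "f \<noteq> g"
  then obtain x where x: "f x \<noteq> g x" by (auto simp: fun_eq_iff)
  then have "x \<in> U" using fg by (auto simp: mem_C_space)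
  then obtain A where A: "A \<in> cartesian_open_factors U" "x \<in> box_of A"
    using locally_cartesian_factors assms(3) by blast
  have 0: "enat 0 \<le> \<alpha> i" for i by (simp add: zero_enat_def[symmetric])
  let ?p = "point_0 x"
  have ext: "diff_ext smul E A (\<lambda>_. 0) h ?p = h x" if "h \<in> topspace ?D" for h
    using diff_ext_is_diff_ext[OF assms(2) that A(1), of "\<lambda>_. 0"] 0
    by (intro diff_ext_0_point[OF assms(1) _ A(2)]) auto
  have "f x \<in> topspace E" "g x \<in> topspace E"
    using fg \<open>x \<in> U\<close> by (auto simp: mem_C_space C_map_def)
  then obtain P Q where PQ: "openin E P" "openin E Q" "f x \<in> P" "g x \<in> Q" "disjnt P Q"
    using assms(2) x unfolding Hausdorff_space_def by metis
  let ?N = "\<lambda>W. {h \<in> topspace ?D. diff_ext smul E A (\<lambda>_. 0) h ` {?p} \<subseteq> W}"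
  have "?p \<in> topspace (multi_space A (\<lambda>_. 0))"
    using point_0_in_multi_distinct[OF A(2)] multi_distinct_subset by blast
  then have "openin ?D (?N P)" "openin ?D (?N Q)"
    using openin_C_space[OF assms(2) A(1), of "\<lambda>_. 0" \<alpha> "{?p}"] PQ 0 by auto
  moreover have "f \<in> ?N P" "g \<in> ?N Q" using ext fg PQ by auto
  moreover have "disjnt (?N P) (?N Q)" using PQ(5) by (auto simp: disjnt_def)
  ultimately show "\<exists>P Q. openin ?D P \<and> openin ?D Q \<and> f \<in> P \<and> g \<in> Q \<and> disjnt P Q" by blast
qed

subsection \<open>Partial extensions\<close>

context topological_vector_space
begin

lemma continuous_map_sum_scale:
  assumes "finite J" "\<And>j. j \<in> J \<Longrightarrow> continuous_map X E (h j)"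
  shows "continuous_map X E (\<lambda>x. \<Sum>j\<in>J. smul (c j) (h j x))"
  using assms
proof (induction J)
  case empty
  have "0 \<in> topspace E" using subspace_topspace by (rule subspace_0)
  then show ?case by simp
next
  case (insert j J)
  have "continuous_map X (prod_topology euclidean E) (\<lambda>x. (c j, h j x))"
    using insert.prems by (simp add: continuous_map_pairwise comp_def)
  from continuous_map_compose[OF this continuous_scale]
  have "continuous_map X E (\<lambda>x. smul (c j) (h j x))" by (simp add: comp_def)
  then have "continuous_map X (prod_topology E E) (\<lambda>x. (smul (c j) (h j x), \<Sum>j\<in>J. smul (c j) (h j x)))"
    using insert by (simp add: continuous_map_pairwise comp_def)
  from continuous_map_compose[OF this continuous_add] insert.hyps
  show ?case by (simp add: comp_def)
qed

end

lemma diff_quot_cong: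
  assumes "\<And>j. \<forall>i. j i \<le> a i \<Longrightarrow> f (\<chi> i. x (i, j i)) = g (\<chi> i. x (i, j i))"
  shows "diff_quot smul a f x = diff_quot smul a g x"
  using assms by (simp add: diff_quot_def)

locale C_map_on_product = topological_vector_space smul E
  for smul :: "'k::topological_field \<Rightarrow> 'e::ab_group_add \<Rightarrow> 'e" and E +
  fixes U :: "('k ^ 'n::finite) set" and V :: "('k ^ 'm::finite) set"
    and \<alpha> :: "'n \<Rightarrow> enat" and \<beta> :: "'m \<Rightarrow> enat"
  assumes U: "locally_cartesian U" and V: "locally_cartesian V"
begin

abbreviation "CUV \<equiv> C_space smul E (case_sum \<alpha> \<beta>) (vec_Times U V)"
abbreviation "CV \<equiv> C_space smul E \<beta> V"
abbreviation "CUCV \<equiv> C_space (fun_scale smul) CV \<alpha> U"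

lemma vector_space: "vector_space smul" ..

lemma Hausdorff_CV: "Hausdorff_space CV"
  using Hausdorff_C_space[OF vector_space Hausdorff V] .

lemma case_sum_le:
  "(\<And>i. enat (a i) \<le> \<alpha> i) \<Longrightarrow> (\<And>i. enat (b i) \<le> \<beta> i) \<Longrightarrow> enat (case_sum a b i) \<le> case_sum \<alpha> \<beta> i"
  by (cases i) auto

lemma enat_0_le: "enat 0 \<le> q"
  by (simp add: zero_enat_def[symmetric])

lemma is_diff_ext_joint:
  assumes "f \<in> topspace CUV" "A \<in> cartesian_open_factors U" "\<And>i. enat (a i) \<le> \<alpha> i"
    "B \<in> cartesian_open_factors V" "\<And>i. enat (b i) \<le> \<beta> i"
  shows "is_diff_ext smul E (case_sum A B) (case_sum a b) f (diff_ext smul E (case_sum A B) (case_sum a b) f)"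
  by (rule diff_ext_is_diff_ext[OF Hausdorff assms(1) cartesian_open_factors_vec_Times[OF assms(2,4)]
        case_sum_le[OF assms(3,5)]])

text \<open>The joint extension of order \<open>(a, 0)\<close> is frozen at \<open>point_0 v\<close>
  in its second argument. Order 0 contributes no difference in the second variable, so what remains
  extends the quotient of the slice at \<open>v\<close>.\<close>

lemma is_diff_ext_section:
  assumes f: "f \<in> topspace CUV" and A: "A \<in> cartesian_open_factors U" and a: "\<And>i. enat (a i) \<le> \<alpha> i"
    and "v \<in> V"
  shows "is_diff_ext smul E A a (\<lambda>u. f (vec_append u v)) (diff_ext smul E A a (\<lambda>u. f (vec_append u v)))"
proof -
  obtain B where B: "B \<in> cartesian_open_factors V" "v \<in> box_of B"
    using locally_cartesian_factors[OF V \<open>v \<in> V\<close>] by blast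
  define g where "g = diff_ext smul E (case_sum A B) (case_sum a (\<lambda>_. 0)) f"
  have g: "is_diff_ext smul E (case_sum A B) (case_sum a (\<lambda>_. 0)) f g"
    unfolding g_def by (rule is_diff_ext_joint[OF f A a B(1) enat_0_le])
  have p: "point_0 v \<in> multi_distinct B (\<lambda>_. 0)" using B by (intro point_0_in_multi_distinct)
  then have pt: "point_0 v \<in> topspace (multi_space B (\<lambda>_. 0))" using multi_distinct_subset by blast
  have "continuous_map (multi_space A a) E (g \<circ> (\<lambda>x. multi_append x (point_0 v)))"
    using g by (intro continuous_map_compose[OF continuous_map_multi_append_left[OF pt]])
      (simp add: is_diff_ext_def continuous_maps_def)
  then have "continuous_map (multi_space A a) E
      (restrict (\<lambda>x. g (multi_append x (point_0 v))) (topspace (multi_space A a)))"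
    by (rule continuous_map_eq) simp
  moreover have "g (multi_append x (point_0 v)) = diff_quot smul a (\<lambda>u. f (vec_append u v)) x"
    if "x \<in> multi_distinct A a" for x
    using g that p multi_append_in_multi_distinct_iff[of x "point_0 v" A B a "\<lambda>_. 0"]
    by (simp add: is_diff_ext_def diff_quot_multi_append[OF vector_space] diff_quot_0[OF vector_space])
  ultimately have "is_diff_ext smul E A a (\<lambda>u. f (vec_append u v))
      (restrict (\<lambda>x. g (multi_append x (point_0 v))) (topspace (multi_space A a)))"
    using multi_distinct_subset[of A a] by (auto simp: is_diff_ext_def continuous_maps_def)
  moreover from this
  have "diff_ext smul E A a (\<lambda>u. f (vec_append u v)) =
      restrict (\<lambda>x. g (multi_append x (point_0 v))) (topspace (multi_space A a))"
    by (rule diff_ext_eqI[OF Hausdorff cartesian_open_factors_no_isolated_points[OF A]])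
  ultimately show ?thesis by simp
qed

text \<open>
  This turns out to be the value at \<open>x\<close> of the extended difference quotient of the curried map.
\<close>

definition partial_ext ::
  "('k ^ ('n + 'm) \<Rightarrow> 'e) \<Rightarrow> ('n \<Rightarrow> 'k set) \<Rightarrow> ('n \<Rightarrow> nat) \<Rightarrow> ('n \<times> nat \<Rightarrow> 'k) \<Rightarrow> 'k ^ 'm \<Rightarrow> 'e" where
  "partial_ext f A a x = (\<lambda>v. if v \<in> V then diff_ext smul E A a (\<lambda>u. f (vec_append u v)) x else 0)"

context
  fixes f :: "'k ^ ('n + 'm) \<Rightarrow> 'e" and A :: "'n \<Rightarrow> 'k set" and a :: "'n \<Rightarrow> nat"
  assumes f: "f \<in> topspace CUV" and A: "A \<in> cartesian_open_factors U" and a: "\<And>i. enat (a i) \<le> \<alpha> i"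
begin

lemma continuous_map_partial_ext:
  assumes "v \<in> V"
  shows "continuous_map (multi_space A a) E (\<lambda>x. partial_ext f A a x v)"
proof -
  have "is_diff_ext smul E A a (\<lambda>u. f (vec_append u v)) (diff_ext smul E A a (\<lambda>u. f (vec_append u v)))"
    by (rule is_diff_ext_section[OF f A a assms])
  then have "continuous_map (multi_space A a) E (diff_ext smul E A a (\<lambda>u. f (vec_append u v)))"
    by (simp add: is_diff_ext_def continuous_maps_def)
  then show ?thesis using assms by (simp add: partial_ext_def)
qed

lemma partial_ext_distinct:
  assumes "v \<in> V" "x \<in> multi_distinct A a"
  shows "partial_ext f A a x v = diff_quot smul a (\<lambda>u. f (vec_append u v)) x"
  using is_diff_ext_section[OF f A a assms(1)] assms by (simp add: is_diff_ext_def partial_ext_def)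

text \<open>An extension in \<open>y\<close> has to match the quotient only at distinct
  \<open>y\<close>, while \<open>x\<close> may have repeated entries. So \<open>y\<close> is fixed
  and density is used in \<open>x\<close>: both sides are continuous in \<open>x\<close> and agree
  at distinct \<open>x\<close> by the rearranged sum.\<close>

lemma is_diff_ext_partial_ext:
  assumes B: "B \<in> cartesian_open_factors V" and b: "\<And>i. enat (b i) \<le> \<beta> i"
    and x: "x \<in> topspace (multi_space A a)"
  shows "is_diff_ext smul E B b (partial_ext f A a x)
    (restrict (\<lambda>y. diff_ext smul E (case_sum A B) (case_sum a b) f (multi_append x y))
      (topspace (multi_space B b)))"
proof -
  define g where "g = diff_ext smul E (case_sum A B) (case_sum a b) f"
  have g: "is_diff_ext smul E (case_sum A B) (case_sum a b) f g"
    unfolding g_def by (rule is_diff_ext_joint[OF f A a B b])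
  then have gc: "continuous_map (multi_space (case_sum A B) (case_sum a b)) E g"
    by (simp add: is_diff_ext_def continuous_maps_def)
  have "continuous_map (multi_space B b) E (g \<circ> multi_append x)"
    by (rule continuous_map_compose[OF continuous_map_multi_append_right[OF x] gc])
  then have "continuous_map (multi_space B b) E (restrict (\<lambda>y. g (multi_append x y)) (topspace (multi_space B b)))"
    by (rule continuous_map_eq) simp
  moreover have "g (multi_append x y) = diff_quot smul b (partial_ext f A a x) y"
    if y: "y \<in> multi_distinct B b" for y
  proof -
    have yt: "y \<in> topspace (multi_space B b)" using y multi_distinct_subset by blast
    have point: "(\<chi> i. y (i, j i)) \<in> V" if "\<forall>i. j i \<le> b i" for j
      using multi_space_point_in_box_of[OF yt that] cartesian_open_factors_subset[OF B] by blast
    have "continuous_map (multi_space A a) E (g \<circ> (\<lambda>x. multi_append x y))"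
      by (rule continuous_map_compose[OF continuous_map_multi_append_left[OF yt] gc])
    then have 1: "continuous_map (multi_space A a) E (\<lambda>x. g (multi_append x y))" by (simp add: comp_def)
    \<comment> \<open>With \<open>y\<close> fixed this is a finite linear combination, with
      coefficients independent of \<open>x\<close>, of the maps
      \<open>x \<mapsto> partial_ext f A a x v\<close> at points \<open>v\<close> of
      \<open>V\<close>.\<close>
    have 2: "continuous_map (multi_space A a) E (\<lambda>x. diff_quot smul b (partial_ext f A a x) y)"
      unfolding diff_quot_def
      by (intro continuous_map_sum_scale finite_multi_indices continuous_map_partial_ext) (simp add: point)
    have 3: "g (multi_append x y) = diff_quot smul b (partial_ext f A a x) y"
      if x: "x \<in> multi_distinct A a" for x
    proof -
      have "g (multi_append x y) = diff_quot smul b (\<lambda>v. diff_quot smul a (\<lambda>u. f (vec_append u v)) x) y"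
        using g x y multi_append_in_multi_distinct_iff[of x y A B a b]
        by (simp add: is_diff_ext_def diff_quot_multi_append[OF vector_space])
      also have "\<dots> = diff_quot smul b (partial_ext f A a x) y"
        by (rule diff_quot_cong) (simp add: partial_ext_distinct[OF point x])
      finally show ?thesis .
    qed
    show ?thesis
      by (rule forall_in_closure_of_eq[OF
            multi_distinct_dense[OF cartesian_open_factors_no_isolated_points[OF A] x] Hausdorff 1 2 3])
  qed
  ultimately show ?thesis
    using multi_distinct_subset[of B b] unfolding g_def[symmetric]
    by (auto simp: is_diff_ext_def continuous_maps_def)
qed

lemma diff_ext_partial_ext:
  assumes B: "B \<in> cartesian_open_factors V" and b: "\<And>i. enat (b i) \<le> \<beta> i"
    and x: "x \<in> topspace (multi_space A a)" and y: "y \<in> topspace (multi_space B b)"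
  shows "diff_ext smul E B b (partial_ext f A a x) y =
    diff_ext smul E (case_sum A B) (case_sum a b) f (multi_append x y)"
  using diff_ext_eqI[OF Hausdorff cartesian_open_factors_no_isolated_points[OF B]
      is_diff_ext_partial_ext[OF B b x]] y
  by simp

lemma partial_ext_in_CV:
  assumes x: "x \<in> topspace (multi_space A a)"
  shows "partial_ext f A a x \<in> topspace CV"
proof -
  have "partial_ext f A a x v \<in> topspace E" if "v \<in> V" for v
    using continuous_map_partial_ext[OF that] x by (auto simp: continuous_map_def)
  moreover have "\<exists>g. is_diff_ext smul E B b (partial_ext f A a x) g"
    if "B \<in> cartesian_open_factors V" "\<forall>i. enat (b i) \<le> \<beta> i" for B b
    using is_diff_ext_partial_ext[OF that(1) _ x] that(2) by blast
  ultimately show ?thesis by (auto simp: mem_C_space C_map_def partial_ext_def)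
qed

text \<open>Continuity into \<open>CV\<close> is tested on each extension of order \<open>b\<close>
  over a box \<open>B\<close>. There the map in question is the curried joint extension, so the tube
  lemma applies.\<close>

lemma is_diff_ext_curry_vec:
  "is_diff_ext (fun_scale smul) CV A a (curry_vec f) (restrict (partial_ext f A a) (topspace (multi_space A a)))"
proof -
  have "continuous_map (multi_space A a) CV (partial_ext f A a)"
  proof (rule continuous_map_into_C_space[OF Hausdorff partial_ext_in_CV])
    fix B b assume B: "B \<in> cartesian_open_factors V" and b: "\<And>i. enat (b i) \<le> \<beta> i"
    define g where "g = diff_ext smul E (case_sum A B) (case_sum a b) f"
    have "continuous_map (multi_space (case_sum A B) (case_sum a b)) E g"
      using is_diff_ext_joint[OF f A a B b] by (simp add: is_diff_ext_def continuous_maps_def g_def)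
    from continuous_map_compose[OF continuous_map_multi_append this]
    have gc: "continuous_map (prod_topology (multi_space A a) (multi_space B b)) E
        (\<lambda>(x, y). g (multi_append x y))"
      by (simp add: comp_def case_prod_unfold)
    show "continuous_map (multi_space A a) (compact_open_topology (multi_space B b) E)
        (\<lambda>x. diff_ext smul E B b (partial_ext f A a x))"
    proof (rule continuous_map_compact_open_topology)
      show "diff_ext smul E B b (partial_ext f A a x) \<in> continuous_maps (multi_space B b) E"
        if "x \<in> topspace (multi_space A a)" for x
        by (rule diff_ext_in_continuous_maps[OF Hausdorff B b partial_ext_in_CV[OF that]])
      fix L W assume L: "compactin (multi_space B b) L" and W: "openin E W"
      have LB: "L \<subseteq> topspace (multi_space B b)" using L by (rule compactin_subset_topspace)
      have "{x \<in> topspace (multi_space A a). diff_ext smul E B b (partial_ext f A a x) ` L \<subseteq> W} =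
          {x \<in> topspace (multi_space A a). \<forall>y\<in>L. (\<lambda>(x, y). g (multi_append x y)) (x, y) \<in> W}"
        using diff_ext_partial_ext[OF B b] LB by (auto simp: g_def image_subset_iff subset_iff)
      then show "openin (multi_space A a)
          {x \<in> topspace (multi_space A a). diff_ext smul E B b (partial_ext f A a x) ` L \<subseteq> W}"
        using openin_forall_compact[OF gc L W] by simp
    qed
  qed
  then have "continuous_map (multi_space A a) CV (restrict (partial_ext f A a) (topspace (multi_space A a)))"
    by (rule continuous_map_eq) simp
  \<comment> \<open>This is an equality of functions on the whole of \<open>'k ^ 'm\<close>, so the
    value 0 outside \<open>V\<close>, shared by \<open>f\<close> and \<open>partial_ext\<close>,
    matters.\<close>
  moreover have "partial_ext f A a x = diff_quot (fun_scale smul) a (curry_vec f) x"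
    if x: "x \<in> multi_distinct A a" for x
  proof
    fix v
    show "partial_ext f A a x v = diff_quot (fun_scale smul) a (curry_vec f) x v"
    proof (cases "v \<in> V")
      case True
      then show ?thesis
        using partial_ext_distinct[OF _ x] by (simp add: diff_quot_fun_scale_apply curry_vec_def)
    next
      case False
      then have "f (vec_append u v) = 0" for u using f by (simp add: mem_C_space)
      then have "diff_quot (fun_scale smul) a (curry_vec f) x v = diff_quot smul a (\<lambda>u. 0) x"
        by (simp add: diff_quot_fun_scale_apply curry_vec_def)
      then show ?thesis using False by (simp add: partial_ext_def diff_quot_def)
    qed
  qed
  ultimately show ?thesis
    using multi_distinct_subset[of A a] by (auto simp: is_diff_ext_def continuous_maps_def)
qed

lemma diff_ext_curry_vec:
  assumes "x \<in> topspace (multi_space A a)"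
  shows "diff_ext (fun_scale smul) CV A a (curry_vec f) x = partial_ext f A a x"
  using diff_ext_eqI[OF Hausdorff_CV cartesian_open_factors_no_isolated_points[OF A] is_diff_ext_curry_vec] assms
  by simp

text \<open>All conditions on compact sets are transported between \<open>f\<close> and
  \<open>curry_vec f\<close> through this identity.\<close>

lemma diff_ext_diff_ext_curry_vec:
  assumes "B \<in> cartesian_open_factors V" "\<And>i. enat (b i) \<le> \<beta> i"
    "x \<in> topspace (multi_space A a)" "y \<in> topspace (multi_space B b)"
  shows "diff_ext smul E B b (diff_ext (fun_scale smul) CV A a (curry_vec f) x) y =
    diff_ext smul E (case_sum A B) (case_sum a b) f (multi_append x y)"
  using assms by (simp add: diff_ext_curry_vec diff_ext_partial_ext)

end

subsection \<open>The exponential law\<close>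

text \<open>The function f(x,.) is the \<open>partial_ext\<close> of order 0 at
  \<open>point_0 x\<close>, so it inherits the C^\<beta> property proved for all partial
  extensions.\<close>

lemma curry_vec_in_CV:
  assumes f: "f \<in> topspace CUV" and "x \<in> U"
  shows "curry_vec f x \<in> topspace CV"
proof -
  obtain A where A: "A \<in> cartesian_open_factors U" "x \<in> box_of A"
    using locally_cartesian_factors[OF U \<open>x \<in> U\<close>] by blast
  have "partial_ext f A (\<lambda>_. 0) (point_0 x) = curry_vec f x"
  proof
    fix v
    show "partial_ext f A (\<lambda>_. 0) (point_0 x) v = curry_vec f x v"
    proof (cases "v \<in> V")
      case True
      then show ?thesis
        using diff_ext_0_point[OF vector_space is_diff_ext_section[OF f A(1) enat_0_le True] A(2)]
        by (simp add: partial_ext_def curry_vec_def)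
    next
      case False
      then show ?thesis using f by (simp add: partial_ext_def curry_vec_def mem_C_space)
    qed
  qed
  moreover have "point_0 x \<in> topspace (multi_space A (\<lambda>_. 0))"
    using point_0_in_multi_distinct[OF A(2)] multi_distinct_subset by blast
  ultimately show ?thesis using partial_ext_in_CV[OF f A(1) enat_0_le] by metis
qed

lemma curry_vec_in_CUCV:
  assumes f: "f \<in> topspace CUV"
  shows "curry_vec f \<in> topspace CUCV"
proof -
  have "\<exists>g. is_diff_ext (fun_scale smul) CV A a (curry_vec f) g"
    if "A \<in> cartesian_open_factors U" "\<forall>i. enat (a i) \<le> \<alpha> i" for A a
    using is_diff_ext_curry_vec[OF f that(1)] that(2) by blast
  moreover have "curry_vec f x = 0" if "x \<notin> U" for x
    using f that by (auto simp: mem_C_space curry_vec_def fun_eq_iff)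
  ultimately show ?thesis
    using curry_vec_in_CV[OF f] by (auto simp: mem_C_space[of _ "fun_scale smul"] C_map_def[of "fun_scale smul"])
qed

section \<open>The topological embedding\<close>

text \<open>By \<open>continuous_map_compact_open_generated\<close> only subbasic sets of
  \<open>CV\<close> need testing. For these, the nested condition on compact sets \<open>K\<close>
  and \<open>L\<close> is the single condition that the joint extension maps the compact set
  \<open>multi_append (K x L)\<close> into \<open>W\<close>.\<close>

lemma continuous_map_curry_vec: "continuous_map CUV CUCV curry_vec"
proof (rule continuous_map_into_C_space[OF Hausdorff_CV curry_vec_in_CUCV])
  fix A a assume A: "A \<in> cartesian_open_factors U" and a: "\<And>i. enat (a i) \<le> \<alpha> i"
  let ?g = "\<lambda>f. diff_ext (fun_scale smul) CV A a (curry_vec f)"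
  have g: "?g f \<in> continuous_maps (multi_space A a) CV" if "f \<in> topspace CUV" for f
    by (rule diff_ext_in_continuous_maps[OF Hausdorff_CV A a curry_vec_in_CUCV[OF that]])
  have gim: "?g f ` K \<subseteq> topspace CV" if "f \<in> topspace CUV" "compactin (multi_space A a) K" for f K
    using g[OF that(1)] compactin_subset_topspace[OF that(2)]
    by (auto simp: continuous_maps_def continuous_map_def)
  define \<S> where "\<S> = insert (topspace CV)
    {{f \<in> topspace CV. diff_ext smul E (fst p) (snd p) f ` L \<subseteq> W} |p L W.
      p \<in> C_indices \<beta> V \<and> compactin (multi_space (fst p) (snd p)) L \<and> openin E W}"
  have gen: "CV = topology_generated_by \<S>"
    unfolding \<S>_def by (rule C_space_eq_generated[OF Hausdorff])
  have "continuous_map CUV (compact_open_topology (multi_space A a) (topology_generated_by \<S>)) ?g"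
  proof (rule continuous_map_compact_open_generated[OF Hausdorff_multi_space])
    fix K s
    assume K: "compactin (multi_space A a) K" and "s \<in> \<S>"
    then consider "s = topspace CV" |
      B b L W where "B \<in> cartesian_open_factors V" "\<And>i. enat (b i) \<le> \<beta> i" "compactin (multi_space B b) L"
        "openin E W" "s = {f \<in> topspace CV. diff_ext smul E B b f ` L \<subseteq> W}"
      by (auto simp: \<S>_def C_indices_def)
    then show "openin CUV {f \<in> topspace CUV. ?g f ` K \<subseteq> s}"
    proof cases
      case 1
      then have "{f \<in> topspace CUV. ?g f ` K \<subseteq> s} = topspace CUV" using gim[OF _ K] by blast
      then show ?thesis by simp
    next
      case 2
      note B = 2(1,2)
      let ?M = "(\<lambda>(x, y). multi_append x y) ` (K \<times> L)"
      have M: "compactin (multi_space (case_sum A B) (case_sum a b)) ?M"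
        using K 2(3) by (intro image_compactin[OF _ continuous_map_multi_append]) (simp add: compactin_Times)
      have KL: "K \<subseteq> topspace (multi_space A a)" "L \<subseteq> topspace (multi_space B b)"
        using K 2(3) compactin_subset_topspace by blast+
      have "?g f ` K \<subseteq> s \<longleftrightarrow> diff_ext smul E (case_sum A B) (case_sum a b) f ` ?M \<subseteq> W"
        if f: "f \<in> topspace CUV" for f
      proof -
        have "?g f ` K \<subseteq> s \<longleftrightarrow> (\<forall>x\<in>K. \<forall>y\<in>L. diff_ext smul E B b (?g f x) y \<in> W)"
          using gim[OF f K] by (auto simp: 2(5))
        also have "\<dots> \<longleftrightarrow> (\<forall>x\<in>K. \<forall>y\<in>L. diff_ext smul E (case_sum A B) (case_sum a b) f (multi_append x y) \<in> W)"
          using diff_ext_diff_ext_curry_vec[OF f A a B] KL by (simp add: subset_iff)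
        finally show ?thesis by auto
      qed
      then have "{f \<in> topspace CUV. ?g f ` K \<subseteq> s} =
          {f \<in> topspace CUV. diff_ext smul E (case_sum A B) (case_sum a b) f ` ?M \<subseteq> W}"
        by blast
      then show ?thesis
        using openin_C_space[OF Hausdorff cartesian_open_factors_vec_Times[OF A B(1)] case_sum_le[OF a B(2)] M 2(4)]
        by simp
    qed
  qed (unfold gen[symmetric], rule g)
  then show "continuous_map CUV (compact_open_topology (multi_space A a) CV) ?g"
    unfolding gen[symmetric] .
qed

lemma topspace_multi_space_eq_empty:
  assumes "box_of C = {}"
  shows "topspace (multi_space C c) = {}"
proof (rule equals0I)
  fix x assume "x \<in> topspace (multi_space C c)"
  then have "(\<chi> i. x (i, 0)) \<in> box_of C" by (rule multi_space_point_in_box_of) simp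
  then show False using assms by simp
qed

lemma embedding_map_curry_vec: "embedding_map CUV CUCV curry_vec"
proof -
  define \<S> where "\<S> = insert (topspace CUV)
    {{f \<in> topspace CUV. diff_ext smul E (fst p) (snd p) f ` K \<subseteq> W} |p K W.
      p \<in> C_indices (case_sum \<alpha> \<beta>) (vec_Times U V) \<and> compactin (multi_space (fst p) (snd p)) K \<and> openin E W}"
  have gen: "CUV = topology_generated_by \<S>"
    unfolding \<S>_def by (rule C_space_eq_generated[OF Hausdorff])
  have "embedding_map (topology_generated_by \<S>) CUCV curry_vec"
  proof (rule embedding_map_generated, unfold gen[symmetric])
    show "inj_on curry_vec (topspace CUV)"
    proof (rule inj_onI, rule ext)
      fix f g :: "'k ^ ('n + 'm) \<Rightarrow> 'e" and z assume "curry_vec f = curry_vec g"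
      then show "f z = g z"
        by (cases z rule: vec_append_cases) (simp add: curry_vec_def fun_eq_iff)
    qed
    fix s f assume "s \<in> \<S>" and fs: "f \<in> s"
    then consider "s = topspace CUV" |
      C c M W where "C \<in> cartesian_open_factors (vec_Times U V)" "\<And>i. enat (c i) \<le> case_sum \<alpha> \<beta> i"
        "compactin (multi_space C c) M" "openin E W" "s = {f \<in> topspace CUV. diff_ext smul E C c f ` M \<subseteq> W}"
      by (auto simp: \<S>_def C_indices_def)
    then show "\<exists>T. openin CUCV T \<and> curry_vec f \<in> T \<and> (\<forall>f'\<in>topspace CUV. curry_vec f' \<in> T \<longrightarrow> f' \<in> s)"
    proof cases
      case 1
      then show ?thesis using curry_vec_in_CUCV fs by (intro exI[of _ "topspace CUCV"]) auto
    next
      case 2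
      have f: "f \<in> topspace CUV" and fM: "diff_ext smul E C c f ` M \<subseteq> W" using fs 2(5) by auto
      show ?thesis
      proof (cases "box_of C = {}")
        \<comment> \<open>An empty box need not have factors that are relatively open in
          \<open>U\<close> and \<open>V\<close>, so it is treated apart; here the compact set is
          empty and \<open>s\<close> is the whole space.\<close>
        case True
        then have "M = {}" using topspace_multi_space_eq_empty compactin_subset_topspace[OF 2(3)] by blast
        then have "s = topspace CUV" using 2(5) by simp
        then show ?thesis using curry_vec_in_CUCV f by (intro exI[of _ "topspace CUCV"]) auto
      next
        case False
        define A B a b where AB: "A = C \<circ> Inl" "B = C \<circ> Inr" "a = c \<circ> Inl" "b = c \<circ> Inr"
        have C: "C = case_sum A B" "c = case_sum a b"
          by (simp_all add: AB fun_eq_iff split_sum_all)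
        have A: "A \<in> cartesian_open_factors U" and B: "B \<in> cartesian_open_factors V"
          unfolding AB using cartesian_open_factors_vec_Times_components[OF 2(1) False] .
        have a: "enat (a i) \<le> \<alpha> i" for i using 2(2)[of "Inl i"] by (simp add: AB)
        have b: "enat (b i) \<le> \<beta> i" for i using 2(2)[of "Inr i"] by (simp add: AB)
        let ?XY = "prod_topology (multi_space A a) (multi_space B b)"
        let ?g = "\<lambda>f (x, y). diff_ext smul E C c f (multi_append x y)"
        have "continuous_map (multi_space C c) E (diff_ext smul E C c f)"
          using diff_ext_in_continuous_maps[OF Hausdorff 2(1,2) f] by (simp add: continuous_maps_def)
        from continuous_map_compose[OF continuous_map_multi_append this[unfolded C]]
        have "continuous_map ?XY E (?g f)" by (simp add: C comp_def case_prod_unfold)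
        then have op: "openin ?XY {p \<in> topspace ?XY. ?g f p \<in> W}"
          using 2(4) by (rule openin_continuous_map_preimage)
        have M': "compactin ?XY (multi_split ` M)"
          using 2(3) continuous_map_multi_split unfolding C by (rule image_compactin)
        have "multi_split ` M \<subseteq> {p \<in> topspace ?XY. ?g f p \<in> W}"
        proof (rule image_subsetI)
          fix z assume z: "z \<in> M"
          obtain x y where xy: "multi_split z = (x, y)" by fastforce
          then have "multi_append x y = z" by (metis fst_conv multi_append_multi_split snd_conv)
          moreover have "multi_split z \<in> topspace ?XY"
            using compactin_subset_topspace[OF M'] z by blast
          ultimately show "multi_split z \<in> {p \<in> topspace ?XY. ?g f p \<in> W}"
            using fM z by (auto simp: xy)
        qed
        from compactin_prod_rectangle_cover[OF Hausdorff_multi_space Hausdorff_multi_space M' op this]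
        obtain R where R: "finite R"
            "\<forall>p\<in>R. compactin (multi_space A a) (fst p) \<and> compactin (multi_space B b) (snd p) \<and>
              fst p \<times> snd p \<subseteq> {p \<in> topspace ?XY. ?g f p \<in> W}"
            "multi_split ` M \<subseteq> (\<Union>p\<in>R. fst p \<times> snd p)"
          by (elim exE conjE)
        \<comment> \<open>On curried maps, \<open>N p\<close> expresses that the joint extension
          maps the rectangle \<open>fst p \<times> snd p\<close> into \<open>W\<close>. It is
          subbasic in \<open>CUCV\<close> because \<open>fst p\<close> is compact and
          \<open>G (snd p)\<close> is open in \<open>CV\<close>. The rectangles together cover
          \<open>M\<close>, so \<open>T\<close> forces membership in \<open>s\<close>.\<close>
        define G where "G L = {k \<in> topspace CV. diff_ext smul E B b k ` L \<subseteq> W}" for L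
        define N where "N p = {h \<in> topspace CUCV. diff_ext (fun_scale smul) CV A a h ` fst p \<subseteq> G (snd p)}" for p
        define T where "T = (\<Inter>p\<in>R. N p) \<inter> topspace CUCV"
        have "openin CUCV (N p)" if "p \<in> R" for p
        proof -
          have "openin CV (G (snd p))"
            unfolding G_def using bspec[OF R(2) that] by (intro openin_C_space[OF Hausdorff B b _ 2(4)]) simp
          then show ?thesis
            unfolding N_def using bspec[OF R(2) that]
            by (intro openin_C_space[OF Hausdorff_CV A a]) simp_all
        qed
        then have "openin CUCV T" unfolding T_def using R(1) by (intro openin_INT) auto
        moreover have "curry_vec f \<in> T"
        proof -
          have "curry_vec f \<in> N p" if "p \<in> R" for p
          proof -
            have p: "fst p \<subseteq> topspace (multi_space A a)" "snd p \<subseteq> topspace (multi_space B b)"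
                "\<And>x y. x \<in> fst p \<Longrightarrow> y \<in> snd p \<Longrightarrow> ?g f (x, y) \<in> W"
              using bspec[OF R(2) that] compactin_subset_topspace by auto
            have "diff_ext (fun_scale smul) CV A a (curry_vec f) x \<in> G (snd p)" if x: "x \<in> fst p" for x
            proof -
              have "x \<in> topspace (multi_space A a)" using x p(1) by blast
              then have "diff_ext (fun_scale smul) CV A a (curry_vec f) x \<in> topspace CV"
                using diff_ext_in_continuous_maps[OF Hausdorff_CV A a curry_vec_in_CUCV[OF f]]
                by (auto simp: continuous_maps_def continuous_map_def)
              moreover have "diff_ext smul E B b (diff_ext (fun_scale smul) CV A a (curry_vec f) x) y \<in> W"
                if "y \<in> snd p" for y
                using diff_ext_diff_ext_curry_vec[OF f A a B b] p x that by (auto simp: C subset_iff)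
              ultimately show ?thesis unfolding G_def by blast
            qed
            then show ?thesis unfolding N_def using curry_vec_in_CUCV[OF f] by blast
          qed
          then show ?thesis unfolding T_def using curry_vec_in_CUCV[OF f] by blast
        qed
        moreover have "f' \<in> s" if f': "f' \<in> topspace CUV" "curry_vec f' \<in> T" for f'
        proof -
          have "diff_ext smul E C c f' z \<in> W" if z: "z \<in> M" for z
          proof -
            have "multi_split z \<in> (\<Union>p\<in>R. fst p \<times> snd p)" using R(3) imageI[OF z] by (rule subsetD)
            then obtain p where p: "p \<in> R" "multi_split z \<in> fst p \<times> snd p" by (rule UN_E)
            obtain x y where xy: "multi_split z = (x, y)" by fastforce
            then have z_eq: "z = multi_append x y" by (metis fst_conv multi_append_multi_split snd_conv)
            have x: "x \<in> fst p" "y \<in> snd p" using p xy by auto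
            then have top: "x \<in> topspace (multi_space A a)" "y \<in> topspace (multi_space B b)"
              using bspec[OF R(2) p(1)] compactin_subset_topspace by (auto simp: subset_iff)
            have "curry_vec f' \<in> N p" using f' p(1) unfolding T_def by blast
            then have "diff_ext smul E B b (diff_ext (fun_scale smul) CV A a (curry_vec f') x) y \<in> W"
              unfolding N_def G_def using x by blast
            then show ?thesis
              using diff_ext_diff_ext_curry_vec[OF f'(1) A a B b top] by (simp add: C z_eq)
          qed
          then show ?thesis using f'(1) 2(5) by blast
        qed
        ultimately show ?thesis by blast
      qed
    qed
  qed (rule continuous_map_curry_vec)
  then show ?thesis unfolding gen[symmetric] .
qed

section \<open>Surjectivity over metrizable fields\<close>

text \<open>The extension for the uncurried map must be the iterated one, \<open>y\<close>-quotient
  of the value at \<open>x\<close> of the \<open>x\<close>-quotient of \<open>h\<close>. It is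
  separately under control by hypothesis; metrizability of the multi-point spaces, inherited from
  the field, gives its joint continuity.\<close>

lemma curry_vec_surj:
  assumes K: "metrizable_space (euclidean :: 'k topology)" and h: "h \<in> topspace CUCV"
  shows "h \<in> curry_vec ` topspace CUV"
proof -
  define f where "f z = h (\<chi> i. z $ Inl i) (\<chi> i. z $ Inr i)" for z
  have f_append [simp]: "f (vec_append u v) = h u v" for u v by (simp add: f_def)
  have hU: "h u \<in> topspace CV" if "u \<in> U" for u
    using h that by (auto simp: mem_C_space[of _ "fun_scale smul"] C_map_def[of "fun_scale smul"])
  have "\<exists>g. is_diff_ext smul E C c f g"
    if C: "C \<in> cartesian_open_factors (vec_Times U V)" and c: "\<forall>i. enat (c i) \<le> case_sum \<alpha> \<beta> i" for C c
  proof (cases "box_of C = {}")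
    case True
    then have "topspace (multi_space C c) = {}" by (rule topspace_multi_space_eq_empty)
    \<comment> \<open>On the empty space the constant \<open>undefined\<close> is the only
      extensional function.\<close>
    then have "is_diff_ext smul E C c f (\<lambda>_. undefined)"
      by (auto simp: is_diff_ext_def continuous_maps_def continuous_map_def multi_distinct_def)
    then show ?thesis by blast
  next
    case False
    define A B a b where AB: "A = C \<circ> Inl" "B = C \<circ> Inr" "a = c \<circ> Inl" "b = c \<circ> Inr"
    have C_eq: "C = case_sum A B" "c = case_sum a b"
      by (simp_all add: AB fun_eq_iff split_sum_all)
    have A: "A \<in> cartesian_open_factors U" and B: "B \<in> cartesian_open_factors V"
      unfolding AB using cartesian_open_factors_vec_Times_components[OF C False] .
    have a: "enat (a i) \<le> \<alpha> i" for i using c[rule_format, of "Inl i"] by (simp add: AB)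
    have b: "enat (b i) \<le> \<beta> i" for i using c[rule_format, of "Inr i"] by (simp add: AB)
    define k where "k = diff_ext (fun_scale smul) CV A a h"
    have k: "is_diff_ext (fun_scale smul) CV A a h k"
      unfolding k_def by (rule diff_ext_is_diff_ext[OF Hausdorff_CV h A a])
    then have "continuous_map (multi_space A a) CV k" by (simp add: is_diff_ext_def continuous_maps_def)
    then have kc: "k x \<in> topspace CV" if "x \<in> topspace (multi_space A a)" for x
      using that by (auto simp: continuous_map_def)
    have "continuous_map (multi_space A a) (compact_open_topology (multi_space B b) E) (diff_ext smul E B b \<circ> k)"
      by (rule continuous_map_compose[OF \<open>continuous_map _ CV k\<close> continuous_map_diff_ext[OF Hausdorff B b]])
    then have "continuous_map (prod_topology (multi_space A a) (multi_space B b)) E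
        (\<lambda>(x, y). (diff_ext smul E B b \<circ> k) x y)"
      by (rule continuous_map_uncurry_metrizable[OF metrizable_multi_space[OF K] metrizable_multi_space[OF K]])
    from continuous_map_compose[OF continuous_map_multi_split this]
    have "continuous_map (multi_space C c) E
        (\<lambda>z. diff_ext smul E B b (k (fst (multi_split z))) (snd (multi_split z)))" (is "continuous_map _ _ ?g")
      by (simp add: C_eq comp_def case_prod_unfold)
    then have "continuous_map (multi_space C c) E (restrict ?g (topspace (multi_space C c)))"
      by (rule continuous_map_eq) simp
    \<comment> \<open>At distinct \<open>z\<close> both components are distinct, so each extension
      equals its quotient and the finite sums can be merged directly, without a density
      argument.\<close>
    moreover have "?g z = diff_quot smul c f z" if z: "z \<in> multi_distinct C c" for z
    proof -
      obtain x y where xy: "multi_split z = (x, y)" by fastforce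
      then have z_eq: "z = multi_append x y" by (metis fst_conv multi_append_multi_split snd_conv)
      have x: "x \<in> multi_distinct A a" and y: "y \<in> multi_distinct B b"
        using z by (simp_all add: z_eq C_eq multi_append_in_multi_distinct_iff)
      have "x \<in> topspace (multi_space A a)" using x multi_distinct_subset by blast
      from diff_ext_is_diff_ext[OF Hausdorff kc[OF this] B b]
      have "?g z = diff_quot smul b (k x) y" using y by (simp add: xy is_diff_ext_def)
      also have "k x = diff_quot (fun_scale smul) a h x" using k x by (simp add: is_diff_ext_def)
      also have "\<dots> = (\<lambda>v. diff_quot smul a (\<lambda>u. f (vec_append u v)) x)"
        by (simp add: fun_eq_iff diff_quot_fun_scale_apply)
      finally show ?thesis by (simp add: z_eq C_eq diff_quot_multi_append[OF vector_space])
    qed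
    ultimately have "is_diff_ext smul E C c f (restrict ?g (topspace (multi_space C c)))"
      using multi_distinct_subset[of C c] by (auto simp: is_diff_ext_def continuous_maps_def)
    then show ?thesis by blast
  qed
  moreover have "f z \<in> topspace E" if z: "z \<in> vec_Times U V" for z
  proof -
    obtain u v where uv: "u \<in> U" "v \<in> V" "z = vec_append u v" using z by (auto simp: vec_Times_def)
    then have "h u v \<in> topspace E" using hU[OF uv(1)] by (auto simp: mem_C_space C_map_def)
    then show ?thesis by (simp add: uv(3))
  qed
  moreover have "f z = 0" if "z \<notin> vec_Times U V" for z
  proof (cases z rule: vec_append_cases)
    case (1 x y)
    show ?thesis
    proof (cases "x \<in> U")
      case True
      then show ?thesis using that hU[OF True] 1 by (auto simp: mem_C_space)
    next
      case False
      then have "h x = 0" using h by (simp add: mem_C_space[of _ "fun_scale smul"])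
      then show ?thesis using 1 by simp
    qed
  qed
  ultimately have "f \<in> topspace CUV" by (auto simp: mem_C_space C_map_def)
  moreover have "curry_vec f = h" by (simp add: curry_vec_def fun_eq_iff)
  ultimately show ?thesis by blast
qed

lemma homeomorphic_map_curry_vec:
  assumes "metrizable_space (euclidean :: 'k topology)"
  shows "homeomorphic_map CUV CUCV curry_vec"
proof -
  have "curry_vec ` topspace CUV = topspace CUCV"
    using curry_vec_surj[OF assms] curry_vec_in_CUCV by blast
  then show ?thesis using embedding_map_curry_vec by (simp add: embedding_map_def)
qed

lemma linear_map_on_curry_vec:
  "linear_map_on (fun_scale smul) (fun_scale (fun_scale smul)) S curry_vec"
  by (auto simp: linear_map_on_def curry_vec_def fun_scale_def fun_eq_iff)

end

theorem theoremA:
  fixes smul :: "'k::topological_field \<Rightarrow> 'e::ab_group_add \<Rightarrow> 'e"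
    and E :: "'e topology"
    and U :: "('k ^ 'n::finite) set"
    and V :: "('k ^ 'm::finite) set"
    and \<alpha> :: "'n \<Rightarrow> enat"
    and \<beta> :: "'m \<Rightarrow> enat"
  assumes "topological_vector_space smul E"
    and "locally_cartesian U"
    and "locally_cartesian V"
  shows
    "(\<forall>f \<in> topspace (C_space smul E (case_sum \<alpha> \<beta>) (vec_Times U V)). \<forall>x\<in>U.
        curry_vec f x \<in> topspace (C_space smul E \<beta> V)) \<and>
     (\<forall>f \<in> topspace (C_space smul E (case_sum \<alpha> \<beta>) (vec_Times U V)).
        curry_vec f \<in> topspace (C_space (fun_scale smul) (C_space smul E \<beta> V) \<alpha> U)) \<and>
     linear_map_on (fun_scale smul) (fun_scale (fun_scale smul))
       (topspace (C_space smul E (case_sum \<alpha> \<beta>) (vec_Times U V))) curry_vec \<and>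
     embedding_map
       (C_space smul E (case_sum \<alpha> \<beta>) (vec_Times U V))
       (C_space (fun_scale smul) (C_space smul E \<beta> V) \<alpha> U) curry_vec \<and>
     (metrizable_space (euclidean :: 'k topology) \<longrightarrow>
       tvs_isomorphism
         (fun_scale smul) (C_space smul E (case_sum \<alpha> \<beta>) (vec_Times U V))
         (fun_scale (fun_scale smul)) (C_space (fun_scale smul) (C_space smul E \<beta> V) \<alpha> U)
         curry_vec)"
proof -
  interpret C_map_on_product smul E U V \<alpha> \<beta>
    using assms by (simp add: C_map_on_product_def C_map_on_product_axioms_def)
  show ?thesis
    using curry_vec_in_CV curry_vec_in_CUCV linear_map_on_curry_vec embedding_map_curry_vec
      homeomorphic_map_curry_vec
    unfolding tvs_isomorphism_def by blast
qed

end
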